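(* Let $\tau>0$, $\rho>0$, let $A\in\mathbb{C}^{n\times n}$ be Hermitian negative semidefinite with its spectrum contained in the interval $[-4\rho,0]$, and let $\mathbf{y},\mathbf{z}\in\mathbb{C}^n$ be nonzero. Let $L_{\exp}(\tau A,\mathbf{y}\mathbf{z}^H)$ be the Fréchet derivative of the matrix exponential at $\tau A$ in direction $\mathbf{y}\mathbf{z}^H$, and let $L_m^{\mathrm{Arn}}$ be its $m$th Arnoldi approximation (defined in the context). Then the error $\varepsilon_m:=\|L_{\exp}(\tau A,\mathbf{y}\mathbf{z}^H)-L_m^{\mathrm{Arn}}\|$ satisfies $$\varepsilon_m\le 10\,\frac{(4\rho\tau)^2}{m^2}\,e^{-m^2/(5\rho\tau)}\,\|\mathbf{y}\|\,\|\mathbf{z}\|\qquad\text{if }\sqrt{4\rho\tau}\le m\le 2\rho\tau,$$ $$\varepsilon_m\le \frac{40}{\rho\tau}\,e^{-\rho\tau}\left(\frac{e\rho\tau}{m}\right)^m\|\mathbf{y}\|\,\|\mathbf{z}\|\qquad\text{if }m\ge 2\rho\tau.$$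
   Context: $\|\cdot\|$ is the Euclidean vector norm and the matrix 2-norm (spectral norm); ${}^H$ is the conjugate transpose; $\mathbf{e}_1$ is the first canonical unit vector of $\mathbb{C}^m$. The Fréchet derivative $L_f(M,\cdot)$ of a matrix function $f$ at $M$ is the unique linear operator with $f(M+E)-f(M)=L_f(M,E)+o(\|E\|)$. Arnoldi approximation: let $\mathcal{K}_m(A,\mathbf{y})=\mathrm{span}\{\mathbf{y},A\mathbf{y},\dots,A^{m-1}\mathbf{y}\}$. Here $m\ge1$ is an integer such that $\mathcal{K}_m(A,\mathbf{y})$ and $\mathcal{K}_m(A^H,\mathbf{z})$ both have dimension $m$. Let $V_m,W_m\in\mathbb{C}^{n\times m}$ have orthonormal columns forming bases of $\mathcal{K}_m(A,\mathbf{y})$ and $\mathcal{K}_m(A^H,\mathbf{z})$ generated by the Arnoldi process, so that $V_m\mathbf{e}_1=\mathbf{y}/\|\mathbf{y}\|$, $W_m\mathbf{e}_1=\mathbf{z}/\|\mathbf{z}\|$, and let $G_m=V_m^HAV_m$, $H_m=W_m^HA^HW_m$ (upper Hessenberg). Then $$L_m^{\mathrm{Arn}}:=V_mX_mW_m^H,\qquad X_m=\frac{1}{2\pi i}\int_\Gamma e^{\lambda}\,\|\mathbf{y}\|\,\|\mathbf{z}\|\,(\lambda I-\tau G_m)^{-1}\mathbf{e}_1\mathbf{e}_1^H(\lambda I-\tau H_m^H)^{-1}\,d\lambda,$$ where $\Gamma$ winds exactly once around the spectra of $\tau G_m$ and $\tau H_m$. Equivalently, $X_m$ is the $(1,2)$-block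 of $\exp\begin{bmatrix}\tau G_m&\|\mathbf{y}\|\|\mathbf{z}\|\mathbf{e}_1\mathbf{e}_1^H\\0&\tau H_m^H\end{bmatrix}$. *)

theory Defs
  imports "HOL-Complex_Analysis.Complex_Analysis"
begin

section \<open>Complex matrices\<close>

definition ctranspose :: "complex^'n^'m \<Rightarrow> complex^'m^'n" where
  "ctranspose M = (\<chi> i j. cnj (M $ j $ i))"

definition cdot :: "complex^'n \<Rightarrow> complex^'n \<Rightarrow> complex" where
  "cdot x y = (\<Sum>i\<in>UNIV. cnj (x $ i) * y $ i)"

text \<open>The rank-one matrix \<open>y z\<^sup>H\<close>.\<close>

definition outer :: "complex^'m \<Rightarrow> complex^'n \<Rightarrow> complex^'n^'m" where
  "outer y z = (\<chi> i j. y $ i * cnj (z $ j))"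

definition hermitian :: "complex^'n^'n \<Rightarrow> bool" where
  "hermitian A \<longleftrightarrow> ctranspose A = A"

text \<open>Used for Hermitian \<open>A\<close> only, where the quadratic form is real.\<close>

definition negative_semidefinite :: "complex^'n^'n \<Rightarrow> bool" where
  "negative_semidefinite A \<longleftrightarrow> (\<forall>x. Re (cdot x (A *v x)) \<le> 0)"

definition spectrum :: "complex^'n^'n \<Rightarrow> complex set" where
  "spectrum A = {\<mu>. \<exists>v. v \<noteq> 0 \<and> A *v v = \<mu> *s v}"

text \<open>The norm of \<open>complex^'n\<close> is the Euclidean one, so this is the matrix 2-norm;
  the type-class norm on matrices is the Frobenius norm.\<close>

definition spectral_norm :: "complex^'n^'m \<Rightarrow> real" where
  "spectral_norm M = onorm ((*v) M)"

text \<open>On \<open>complex^'n^'n\<close> the operations \<open>*\<close>, \<open>^\<close> and the constant \<open>1\<close> act componentwise,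
  hence \<open>exp\<close> cannot be used here.\<close>

definition mpow :: "complex^'n^'n \<Rightarrow> nat \<Rightarrow> complex^'n^'n" where
  "mpow A k = ((\<lambda>B. A ** B) ^^ k) (mat 1)"

definition mexp :: "complex^'n^'n \<Rightarrow> complex^'n^'n" where
  "mexp A = (\<Sum>k. (1 / fact k) *\<^sub>R mpow A k)"

text \<open>The derivative is taken with respect to the Frobenius norm, which is equivalent to the
  2-norm, and over the reals; a complex-linear operator with the defining property is in
  particular real-linear and therefore agrees with it.\<close>

definition L_exp :: "complex^'n^'n \<Rightarrow> complex^'n^'n \<Rightarrow> complex^'n^'n" where
  "L_exp M E = frechet_derivative mexp (at M) E"


section \<open>Krylov spaces and the Arnoldi process\<close>

definition krylov :: "nat \<Rightarrow> complex^'n^'n \<Rightarrow> complex^'n \<Rightarrow> (complex^'n) set" where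
  "krylov m A y = vec.span ((\<lambda>k. (((*v) A) ^^ k) y) ` {..<m})"

text \<open>The vectors are numbered from 0. After a breakdown the process continues with zero vectors;
  this does not happen for indices below \<open>m\<close> if \<open>krylov m A y\<close> has dimension \<open>m\<close>.\<close>

fun arnoldi :: "complex^'n^'n \<Rightarrow> complex^'n \<Rightarrow> nat \<Rightarrow> complex^'n" where
  "arnoldi A y 0 = y /\<^sub>R norm y"
| "arnoldi A y (Suc j) =
    (let v = arnoldi A y j;
         w = A *v v - (\<Sum>i\<le>j. cdot (arnoldi A y i) (A *v v) *s arnoldi A y i)
     in w /\<^sub>R norm w)"

text \<open>The number of columns is the cardinality of the index type, and \<open>card {..<j}\<close> is the
  position of \<open>j\<close>, counted from 0, in the linear order of this type.\<close>

definition arnoldi_matrix ::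
    "complex^'n^'n \<Rightarrow> complex^'n \<Rightarrow> complex^'m::{finite,linorder}^'n" where
  "arnoldi_matrix A y = (\<chi> i j. arnoldi A y (card {..<j}) $ i)"

definition e1 :: "complex^'m::{finite,linorder}" where
  "e1 = axis (Min UNIV) 1"


subsection \<open>The Arnoldi vectors form an orthonormal Krylov basis\<close>

lemma cdot_simps:
  "cdot x (y - z) = cdot x y - cdot x z"
  "cdot x (c *s y) = c * cdot x y"
  "cdot x (r *\<^sub>R y) = of_real r * cdot x y"
  "cdot x 0 = 0" "cdot 0 x = 0"
  unfolding cdot_def
  by (auto simp: algebra_simps sum_subtractf sum_distrib_left scaleR_sum_right
      simp flip: scaleR_conv_of_real)

lemma cdot_sum: "cdot x (sum f I) = (\<Sum>i\<in>I. cdot x (f i))"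
  unfolding cdot_def by (simp add: sum_distrib_left sum.swap[of _ I])

lemma cdot_self: "cdot x x = of_real ((norm x)\<^sup>2)"
  by (simp add: cdot_def norm_vec_def L2_set_def sum_nonneg mult.commute complex_norm_square[symmetric])

lemma cdot_commute: "cdot y x = cnj (cdot x y)"
  by (simp add: cdot_def mult.commute)

lemma scaleR_eq_smult: "r *\<^sub>R (x::complex^'n) = of_real r *s x"
  by (simp add: vec_eq_iff) (simp add: scaleR_conv_of_real)

lemma arnoldi_norm: "arnoldi A y j = 0 \<or> norm (arnoldi A y j) = 1"
proof -
  have "x /\<^sub>R norm x = 0 \<or> norm (x /\<^sub>R norm x) = 1" for x :: "complex^'n"
    by (cases "x = 0") auto
  then show ?thesis by (cases j) (simp_all only: arnoldi.simps Let_def)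
qed

lemma arnoldi_step:
  "A *v arnoldi A y j \<in> vec.span (arnoldi A y ` {..<Suc (Suc j)})"
proof -
  define v where "v = arnoldi A y j"
  define s where "s = (\<Sum>i\<le>j. cdot (arnoldi A y i) (A *v v) *s arnoldi A y i)"
  have s: "s \<in> vec.span (arnoldi A y ` {..<Suc (Suc j)})"
    unfolding s_def by (intro vec.span_sum vec.span_scale vec.span_base) auto
  have a: "arnoldi A y (Suc j) \<in> vec.span (arnoldi A y ` {..<Suc (Suc j)})"
    by (intro vec.span_base imageI) simp
  have e: "arnoldi A y (Suc j) = (A *v v - s) /\<^sub>R norm (A *v v - s)"
    by (simp add: v_def s_def Let_def)
  have "A *v v - s = norm (A *v v - s) *\<^sub>R arnoldi A y (Suc j)"
    unfolding e by (cases "A *v v - s = 0") (simp_all del: right_minus_eq eq_iff_diff_eq_0)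
  then have "A *v v = s + of_real (norm (A *v v - s)) *s arnoldi A y (Suc j)"
    unfolding scaleR_eq_smult by (metis add.commute diff_add_cancel)
  moreover have "s + of_real (norm (A *v v - s)) *s arnoldi A y (Suc j)
      \<in> vec.span (arnoldi A y ` {..<Suc (Suc j)})"
    by (intro vec.span_add vec.span_scale s a)
  ultimately show ?thesis unfolding v_def by simp
qed

lemma vec_span_map:
  assumes "x \<in> vec.span (S :: (complex^'n) set)" "\<And>s. s \<in> S \<Longrightarrow> A *v s \<in> vec.span T"
  shows "A *v x \<in> vec.span T"
  using assms(1)
proof (induction rule: vec.span_induct_alt)
  case base
  then show ?case by (simp add: vec.span_zero)
next
  case (step c x y)
  then show ?case
    using assms(2) by (simp add: matrix_vector_right_distrib vector_scalar_commute
      vec.span_add vec.span_scale)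
qed

lemma krylov_eq_span_arnoldi: "krylov m A y = vec.span (arnoldi A y ` {..<m})"
proof -
  let ?K = "\<lambda>m. (\<lambda>k. (((*v) A) ^^ k) y) ` {..<m}"
  let ?S = "\<lambda>m. arnoldi A y ` {..<m}"
  have mono: "vec.span (?S k) \<subseteq> vec.span (?S l)" "vec.span (?K k) \<subseteq> vec.span (?K l)"
    if "k \<le> l" for k l
    using that by (auto intro!: vec.span_mono)
  have 1: "(((*v) A) ^^ k) y \<in> vec.span (?S (Suc k))" for k
  proof (induction k)
    case 0
    have "y = of_real (norm y) *s arnoldi A y 0"
      by (cases "y = 0") (simp_all flip: scaleR_eq_smult)
    then show ?case
      by (metis (no_types, lifting) funpow_0 image_eqI lessI lessThan_iff vec.span_base vec.span_scale)
  next
    case (Suc k)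
    have "A *v s \<in> vec.span (?S (Suc (Suc k)))" if s: "s \<in> ?S (Suc k)" for s
    proof -
      from s obtain i where i: "s = arnoldi A y i" "i \<in> {..<Suc k}" by (rule imageE)
      then have "Suc (Suc i) \<le> Suc (Suc k)" by simp
      from subsetD[OF mono(1)[OF this] arnoldi_step] show ?thesis unfolding i(1) .
    qed
    from vec_span_map[OF Suc this] show ?case by simp
  qed
  have 2: "arnoldi A y k \<in> vec.span (?K (Suc k))" for k
  proof (induction k rule: less_induct)
    case (less k)
    show ?case
    proof (cases k)
      case 0
      moreover have "y \<in> vec.span (?K (Suc 0))"
        by (intro vec.span_base) simp
      ultimately show ?thesis
        by (simp only: arnoldi.simps scaleR_eq_smult vec.span_scale)
    next
      case (Suc j)
      have sub: "arnoldi A y i \<in> vec.span (?K (Suc k))" if "i \<le> j" for i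
        using subsetD[OF mono(2)[of "Suc i" "Suc k"] less[of i]] that Suc
        by (simp only: less_Suc_eq_le Suc_le_mono le_SucI)
      have "arnoldi A y j \<in> vec.span (?K (Suc j))"
        by (rule less) (simp only: Suc lessI)
      moreover have "A *v s \<in> vec.span (?K (Suc (Suc j)))" if s: "s \<in> ?K (Suc j)" for s
      proof -
        from s obtain i where i: "s = (((*v) A) ^^ i) y" "i \<in> {..<Suc j}" by (rule imageE)
        then have "A *v s = (((*v) A) ^^ (Suc i)) y" by simp
        moreover have "Suc i \<in> {..<Suc (Suc j)}" using i by simp
        ultimately show ?thesis by (intro vec.span_base image_eqI)
      qed
      ultimately have "A *v arnoldi A y j \<in> vec.span (?K (Suc k))"
        unfolding Suc by (rule vec_span_map)
      moreover have "(\<Sum>i\<le>j. cdot (arnoldi A y i) (A *v arnoldi A y j) *s arnoldi A y i)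
          \<in> vec.span (?K (Suc k))"
        by (intro vec.span_sum vec.span_scale sub) (simp only: atMost_iff)
      ultimately show ?thesis
        unfolding Suc arnoldi.simps Let_def scaleR_eq_smult
        by (intro vec.span_scale vec.span_diff)
    qed
  qed
  show ?thesis
    unfolding krylov_def
  proof (intro equalityI vec.span_minimal vec.subspace_span subsetI)
    fix x assume "x \<in> ?K m"
    then obtain k where k: "x = (((*v) A) ^^ k) y" "k \<in> {..<m}" by (rule imageE)
    then have "Suc k \<le> m" by simp
    from subsetD[OF mono(1)[OF this] 1] show "x \<in> vec.span (?S m)" unfolding k(1) .
  next
    fix x assume "x \<in> ?S m"
    then obtain k where k: "x = arnoldi A y k" "k \<in> {..<m}" by (rule imageE)
    then have "Suc k \<le> m" by simp
    from subsetD[OF mono(2)[OF this] 2] show "x \<in> vec.span (?K m)" unfolding k(1) .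
  qed
qed

lemma arnoldi_orthogonal: "i < j \<Longrightarrow> cdot (arnoldi A y i) (arnoldi A y j) = 0"
proof (induction j arbitrary: i rule: less_induct)
  case (less j)
  then obtain k where j: "j = Suc k" by (cases j) auto
  let ?a = "arnoldi A y"
  have ik: "i \<le> k" using less.prems j by simp
  have orth: "cdot (?a i) (?a l) = 0" if "l \<le> k" "l \<noteq> i" for l
  proof (cases "i < l")
    case True
    then show ?thesis using less.IH[of l i] that j by simp
  next
    case False
    then have "cdot (?a l) (?a i) = 0" using less.IH[of i l] that less.prems by simp
    then show ?thesis by (simp add: cdot_commute[of "?a i" "?a l"])
  qed
  have "(\<Sum>l\<le>k. cdot (?a l) w * cdot (?a i) (?a l)) = cdot (?a i) w" for w
  proof -
    have "(\<Sum>l\<le>k. cdot (?a l) w * cdot (?a i) (?a l))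
        = (\<Sum>l\<in>{i}. cdot (?a l) w * cdot (?a i) (?a l))"
      by (rule sum.mono_neutral_right) (use ik orth in auto)
    then show ?thesis using arnoldi_norm[of A y i] by (auto simp: cdot_self cdot_simps)
  qed
  then show ?case
    unfolding j arnoldi.simps Let_def cdot_simps cdot_sum by simp
qed

lemma bij_position: "bij_betw (\<lambda>j::'m::{finite,linorder}. card {..<j}) UNIV {..<CARD('m)}"
proof -
  have sm: "strict_mono (\<lambda>j::'m. card {..<j})"
    by (intro strict_monoI psubset_card_mono) auto
  have "card {..<j} < CARD('m)" for j :: 'm
    by (intro psubset_card_mono) auto
  then have "(\<lambda>j::'m. card {..<j}) ` UNIV \<subseteq> {..<CARD('m)}" by auto
  moreover have "card ((\<lambda>j::'m. card {..<j}) ` UNIV) = CARD('m)"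
    by (rule card_image[OF strict_mono_imp_inj_on[OF sm]])
  ultimately show ?thesis
    using strict_mono_imp_inj_on[OF sm] by (simp add: bij_betw_def card_subset_eq)
qed

lemma arnoldi_matrix_basis:
  fixes V :: "complex^'m::{finite,linorder}^'n"
  assumes "vec.dim (krylov CARD('m) A y) = CARD('m)"
  defines "V \<equiv> arnoldi_matrix A y"
  shows "ctranspose V ** V = mat 1"
    and "vec.span (range (\<lambda>j. column j V)) = krylov CARD('m) A y"
    and "V *v e1 = y /\<^sub>R norm y"
proof -
  have col: "column j V = arnoldi A y (card {..<j})" for j
    by (simp add: V_def arnoldi_matrix_def column_def vec_eq_iff)
  have "range (\<lambda>j. column j V) = arnoldi A y ` (\<lambda>j::'m. card {..<j}) ` UNIV"
    by (simp add: col image_image)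
  also have "(\<lambda>j::'m. card {..<j}) ` UNIV = {..<CARD('m)}"
    by (rule bij_betw_imp_surj_on[OF bij_position])
  finally show "vec.span (range (\<lambda>j. column j V)) = krylov CARD('m) A y"
    by (simp add: krylov_eq_span_arnoldi)
  have nz: "arnoldi A y k \<noteq> 0" if "k < CARD('m)" for k
  proof
    assume z: "arnoldi A y k = 0"
    let ?S = "arnoldi A y ` ({..<CARD('m)} - {k})"
    have "arnoldi A y ` {..<CARD('m)} \<subseteq> insert 0 ?S" using z by auto
    then have "krylov CARD('m) A y \<subseteq> vec.span ?S"
      unfolding krylov_eq_span_arnoldi
      by (metis vec.span_mono vec.span_insert_0)
    then have "vec.dim (krylov CARD('m) A y) \<le> card ?S"
      by (intro vec.dim_le_card) auto
    also have "\<dots> \<le> card ({..<CARD('m)} - {k})" by (rule card_image_le) auto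
    also have "\<dots> < CARD('m)" using that by simp
    finally show False using assms by simp
  qed
  have nrm: "cdot (column j V) (column j V) = 1" for j
  proof -
    have "card {..<j} < CARD('m)" by (intro psubset_card_mono) auto
    then show ?thesis using nz arnoldi_norm[of A y "card {..<j}"] by (auto simp: col cdot_self)
  qed
  have lt: "card {..<i} < card {..<j}" if "i < j" for i j :: 'm
    using that by (intro psubset_card_mono) auto
  have "cdot (column i V) (column j V) = (if i = j then 1 else 0)" for i j
    using arnoldi_orthogonal[OF lt, of i j A y] arnoldi_orthogonal[OF lt, of j i A y] nrm[of i]
      cdot_commute[of "column i V" "column j V"]
    by (cases i j rule: linorder_cases) (auto simp: col)
  then show "ctranspose V ** V = mat 1"
    by (simp add: vec_eq_iff matrix_matrix_mult_def ctranspose_def mat_def cdot_def column_def)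
  have "{..<Min (UNIV::'m set)} = {}" by (auto simp: not_less)
  then have "column (Min UNIV) V = y /\<^sub>R norm y"
    using col[of "Min UNIV"] by simp
  moreover have "V *v e1 = column (Min UNIV) V"
    by (simp add: e1_def vec_eq_iff matrix_vector_mult_def axis_def column_def
        if_distrib[of "(*) _"] cong: if_cong)
  ultimately show "V *v e1 = y /\<^sub>R norm y" by simp
qed


section \<open>The Arnoldi approximation of the Frechet derivative\<close>

definition winds_once_around :: "(real \<Rightarrow> complex) \<Rightarrow> complex set \<Rightarrow> bool" where
  "winds_once_around \<Gamma> S \<longleftrightarrow>
     valid_path \<Gamma> \<and> pathfinish \<Gamma> = pathstart \<Gamma> \<and>
     (\<forall>s\<in>S. s \<notin> path_image \<Gamma> \<and> winding_number \<Gamma> s = 1)"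

text \<open>The integral of the matrix-valued function is taken entrywise.\<close>

definition arnoldi_core ::
    "real \<Rightarrow> real
      \<Rightarrow> complex^'m::{finite,linorder}^'m::{finite,linorder}
      \<Rightarrow> complex^'m::{finite,linorder}^'m::{finite,linorder}
      \<Rightarrow> (real \<Rightarrow> complex)
      \<Rightarrow> complex^'m::{finite,linorder}^'m::{finite,linorder}" where
  "arnoldi_core \<tau> c G H \<Gamma> =
    (\<chi> i j. 1 / (2 * of_real pi * \<i>) *
       contour_integral \<Gamma> (\<lambda>\<mu>. exp \<mu> * of_real c *
         (matrix_inv (mat \<mu> - \<tau> *\<^sub>R G) ** outer e1 e1 **
          matrix_inv (mat \<mu> - \<tau> *\<^sub>R ctranspose H)) $ i $ j))"

definition arnoldi_G :: "complex^'n^'n \<Rightarrow> complex^'m^'n \<Rightarrow> complex^'m^'m" where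
  "arnoldi_G A V = ctranspose V ** A ** V"

definition L_arnoldi ::
    "real \<Rightarrow> complex^'n^'n \<Rightarrow> complex^'n \<Rightarrow> complex^'n
      \<Rightarrow> complex^'m::{finite,linorder}^'n \<Rightarrow> complex^'m::{finite,linorder}^'n \<Rightarrow> (real \<Rightarrow> complex)
      \<Rightarrow> complex^'n^'n" where
  "L_arnoldi \<tau> A y z V W \<Gamma> =
     V ** arnoldi_core \<tau> (norm y * norm z) (arnoldi_G A V) (arnoldi_G (ctranspose A) W) \<Gamma>
       ** ctranspose W"

end

theory Submission
  imports Defs
begin

text \<open>
  For a polynomial \<open>p\<close> of degree at most \<open>m\<close> the Arnoldi approximation of the Frechet derivative
  is exact, because the derivative of \<open>M ^ k\<close> in direction \<open>y z\<^sup>H\<close> only involves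
  \<open>A ^ i y\<close> and \<open>A ^ j z\<close> with \<open>i, j < m\<close>. Hence the error for \<open>exp\<close> equals the error for
  \<open>exp - p\<close>. In eigenbases of the Hermitian matrices involved, both the Frechet derivative and its
  approximation multiply the entries of the direction by divided differences of \<open>exp - p\<close>, which by
  the mean value theorem are bounded by \<open>sup |exp - p'|\<close> on \<open>[-4\<rho>\<tau>, 0]\<close>; so the error is at most
  \<open>2 sup |exp - q| \<parallel>y\<parallel> \<parallel>z\<parallel>\<close> for every polynomial \<open>q\<close> of degree less than \<open>m\<close>.
  For \<open>q\<close> we take a truncated Chebyshev expansion. With \<open>a = \<rho>\<tau>\<close>, its remainder is the probability
  that the difference of two Poisson variables of mean \<open>a\<close> is at least \<open>m\<close> in absolute value,
  and Chernoff's bound gives \<open>2 exp (a (r + 1 / r) - 2 a) / r ^ m\<close> for every \<open>r \<ge> 1\<close>.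
  The choices \<open>r = exp (m / (2 a))\<close> and \<open>r = m / a\<close> yield the two estimates.
\<close>

section \<open>Chebyshev approximation of the exponential\<close>

fun cheb :: "nat \<Rightarrow> real poly" where
  "cheb 0 = 1"
| "cheb (Suc 0) = [:0, 1:]"
| "cheb (Suc (Suc k)) = [:0, 2:] * cheb (Suc k) - cheb k"

lemma degree_cheb: "degree (cheb k) \<le> k"
proof (induction k rule: cheb.induct)
  case (3 k)
  have "degree ([:0, 2:] * cheb (Suc k)) \<le> Suc (Suc k)"
    using degree_mult_le[of "[:0, 2:]" "cheb (Suc k)"] 3 by simp
  with 3 show ?case by (simp only: cheb.simps degree_diff_le le_SucI)
qed auto

lemma poly_cheb_cos: "poly (cheb k) (cos \<theta>) = cos (real k * \<theta>)"
proof (induction k rule: cheb.induct)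
  case (3 k)
  have "cos (real (Suc (Suc k)) * \<theta>) + cos (real k * \<theta>) = 2 * cos \<theta> * cos (real (Suc k) * \<theta>)"
    by (simp add: cos_plus_cos field_simps) (simp add: algebra_simps add_divide_distrib)
  with 3 show ?case by (simp add: algebra_simps)
qed auto

lemma poly_cheb_cos_int: "poly (cheb (nat \<bar>k\<bar>)) (cos \<theta>) = cos (of_int k * \<theta>)"
  by (cases "k \<ge> 0") (simp_all add: poly_cheb_cos)

text \<open>The real part of the binomial expansion of
  \<open>(cis \<theta> + cis (- \<theta>)) ^ n\<close>. By \<open>poly_cheb_cos_int\<close> it is at
  the same time the Chebyshev expansion of \<open>(2 * t) ^ n\<close> at
  \<open>t = cos \<theta>\<close>.\<close>

lemma cos_power_eq_sum:
  "(2 * cos \<theta>) ^ n = (\<Sum>i\<le>n. real (n choose i) * cos (of_int (2 * int i - int n) * \<theta>))"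
proof -
  have trm: "cis \<theta> ^ i * cis (- \<theta>) ^ (n - i) = cis (of_int (2 * int i - int n) * \<theta>)" if "i \<le> n" for i
    using that by (simp add: Complex.DeMoivre cis_mult of_nat_diff algebra_simps)
  have "complex_of_real (2 * cos \<theta>) ^ n = (cis \<theta> + cis (- \<theta>)) ^ n"
    by (rule arg_cong[of _ _ "\<lambda>x. x ^ n"]) (simp add: complex_eq_iff)
  also have "\<dots> = (\<Sum>i\<le>n. of_nat (n choose i) * cis (of_int (2 * int i - int n) * \<theta>))"
    unfolding binomial_ring by (intro sum.cong) (simp_all add: trm mult.assoc)
  finally have "Re (complex_of_real (2 * cos \<theta>) ^ n)
      = Re (\<Sum>i\<le>n. of_nat (n choose i) * cis (of_int (2 * int i - int n) * \<theta>))"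
    by (rule arg_cong)
  moreover have "Re (complex_of_real (2 * cos \<theta>) ^ n) = (2 * cos \<theta>) ^ n"
    by (simp only: of_real_power[symmetric] Re_complex_of_real)
  moreover have "Re (\<Sum>i\<le>n. of_nat (n choose i) * cis (of_int (2 * int i - int n) * \<theta>))
      = (\<Sum>i\<le>n. real (n choose i) * cos (of_int (2 * int i - int n) * \<theta>))"
    by (simp only: Re_sum times_complex.sel complex_Re_of_nat complex_Im_of_nat cis.sel mult_zero_left diff_zero)
  ultimately show ?thesis by (simp only:)
qed

text \<open>The pointwise form of an exponential Markov inequality: one of the two summands is
  \<open>r\<close> to the power \<open>\<bar>2 * int i - int n\<bar>\<close>, and the other is
  nonnegative.\<close>

lemma one_le_power_shift:
  fixes r :: real
  assumes "r \<ge> 1" "int m \<le> \<bar>2 * int i - int n\<bar>" "i \<le> n"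
  shows "r ^ m \<le> r ^ i * (1 / r) ^ (n - i) + r ^ (n - i) * (1 / r) ^ i"
proof -
  have *: "r ^ m \<le> r ^ a * (1 / r) ^ b" if "m + b \<le> a" for a b
  proof -
    have "r ^ m * r ^ b \<le> r ^ a" using that assms by (simp flip: power_add add: power_increasing)
    then show ?thesis using assms by (simp add: field_simps power_divide)
  qed
  have nn: "0 \<le> r ^ i * (1 / r) ^ (n - i)" "0 \<le> r ^ (n - i) * (1 / r) ^ i"
    using assms by simp_all
  have "m + (n - i) \<le> i \<or> m + i \<le> n - i" using assms by linarith
  then show ?thesis
    using *[of "n - i" i] *[of i "n - i"] nn by force
qed

text \<open>Chernoff's bound for a simple random walk of \<open>n\<close> steps ending at distance
  at least \<open>m\<close> from its start, without the normalization by \<open>2 ^ n\<close>. After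
  weighting with \<open>one_le_power_shift\<close>, both sums over all \<open>i\<close> are binomial
  expansions of \<open>(r + 1 / r) ^ n\<close>.\<close>

lemma binomial_tail_le:
  fixes r :: real
  assumes "r \<ge> 1"
  shows "(\<Sum>i | i \<le> n \<and> int m \<le> \<bar>2 * int i - int n\<bar>. real (n choose i)) \<le> 2 * (r + 1 / r) ^ n / r ^ m"
proof -
  have r: "r > 0" using assms by simp
  have "(\<Sum>i | i \<le> n \<and> int m \<le> \<bar>2 * int i - int n\<bar>. real (n choose i)) * r ^ m
     \<le> (\<Sum>i | i \<le> n \<and> int m \<le> \<bar>2 * int i - int n\<bar>.
          real (n choose i) * (r ^ i * (1 / r) ^ (n - i) + r ^ (n - i) * (1 / r) ^ i))"
    unfolding sum_distrib_right
    by (intro sum_mono mult_left_mono one_le_power_shift assms) auto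
  also have "\<dots> \<le> (\<Sum>i\<le>n. real (n choose i) * (r ^ i * (1 / r) ^ (n - i) + r ^ (n - i) * (1 / r) ^ i))"
    using r by (intro sum_mono2) auto
  also have "\<dots> = (r + 1 / r) ^ n + (1 / r + r) ^ n"
    unfolding binomial_ring by (simp add: sum.distrib algebra_simps)
  also have "\<dots> = 2 * (r + 1 / r) ^ n" by (simp add: add.commute)
  finally show ?thesis using r by (simp add: pos_le_divide_eq)
qed

text \<open>The tail at \<open>t\<close> is dominated by the tail at 1. Truncating uniformly keeps
  the later regrouping by frequency a matter of finite sums; the slack \<open>d\<close> is removed
  in the final theorem.\<close>

lemma exp_partial_sum_tail:
  assumes "d > (0::real)" "b \<ge> (0::real)"
  obtains N where "\<And>t. \<bar>t\<bar> \<le> 1 \<Longrightarrow> \<bar>exp (b * t) - (\<Sum>n<N. (b * t) ^ n / fact n)\<bar> \<le> d"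
proof -
  have s: "(\<lambda>n. x ^ n / fact n) sums exp x" for x :: real
    using exp_converges[of x] by (simp add: divide_inverse mult.commute)
  have "(\<lambda>N. \<Sum>n<N. b ^ n / fact n) \<longlonglongrightarrow> exp b" using s by (simp add: sums_def)
  then obtain N where "dist (\<Sum>n<N. b ^ n / fact n) (exp b) < d"
    using assms(1) by (meson LIMSEQ_iff_nz dual_order.refl metric_LIMSEQ_D)
  then have N: "exp b - (\<Sum>n<N. b ^ n / fact n) \<le> d" by (simp add: dist_real_def)
  show ?thesis
  proof (rule that[of N])
    fix t :: real assume t: "\<bar>t\<bar> \<le> 1"
    let ?f = "\<lambda>n. (b * t) ^ (n + N) / fact (n + N)" and ?g = "\<lambda>n. b ^ (n + N) / fact (n + N)"
    have f: "?f sums (exp (b * t) - (\<Sum>n<N. (b * t) ^ n / fact n))"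
      using s[of "b * t"] by (rule sums_split_initial_segment)
    have g: "?g sums (exp b - (\<Sum>n<N. b ^ n / fact n))"
      using s[of b] by (rule sums_split_initial_segment)
    have le: "norm (?f n) \<le> ?g n" for n
    proof -
      have "\<bar>t\<bar> ^ (n + N) \<le> 1" using t by (simp add: power_le_one)
      then have "b ^ (n + N) * \<bar>t\<bar> ^ (n + N) \<le> b ^ (n + N)" using assms by (simp add: mult_left_le)
      then show ?thesis using assms
        by (simp add: abs_mult power_abs power_mult_distrib divide_right_mono)
    qed
    have "norm (suminf ?f) \<le> suminf ?g"
      by (rule norm_suminf_le[OF le]) (rule sums_summable[OF g])
    then show "\<bar>exp (b * t) - (\<Sum>n<N. (b * t) ^ n / fact n)\<bar> \<le> d"
      using N sums_unique[OF f] sums_unique[OF g] by simp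
  qed
qed

text \<open>With \<open>t = cos \<theta>\<close> every Taylor term becomes a sum of cosines, and the
  frequencies of at least \<open>m\<close> are discarded. \<open>binomial_tail_le\<close> bounds
  what is lost from each term, and summation over the terms gives the exponential of
  \<open>a * (r + 1 / r)\<close>.\<close>

lemma exp_poly_approx_unit:
  fixes a r d :: real
  assumes a: "a > 0" and r: "r \<ge> 1" and d: "d > 0" and m: "m > 0"
  obtains q where "degree q < m"
    "\<And>t. \<bar>t\<bar> \<le> 1 \<Longrightarrow> \<bar>exp (2 * a * t) - poly q t\<bar> \<le> 2 * exp (a * (r + 1 / r)) / r ^ m + d"
proof -
  obtain N where N: "\<And>t. \<bar>t\<bar> \<le> 1 \<Longrightarrow> \<bar>exp (2 * a * t) - (\<Sum>n<N. (2 * a * t) ^ n / fact n)\<bar> \<le> d"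
    using exp_partial_sum_tail[of d "2 * a"] d a by auto
  define k where "k n i = 2 * int i - int n" for n i
  define L where "L n = {i. i \<le> n \<and> \<bar>k n i\<bar> < int m}" for n
  define H where "H n = {i. i \<le> n \<and> int m \<le> \<bar>k n i\<bar>}" for n
  have fin: "finite (L n)" "finite (H n)" "L n \<inter> H n = {}" "L n \<union> H n = {..n}" for n
    by (auto simp: L_def H_def)
  \<comment> \<open>All contributions of frequency below \<open>m\<close>, from every Taylor degree
    \<open>n < N\<close>: the degree stays below \<open>m\<close> however large \<open>N\<close>
    is.\<close>
  define q where "q = (\<Sum>n<N. \<Sum>i\<in>L n. smult (a ^ n / fact n * real (n choose i)) (cheb (nat \<bar>k n i\<bar>)))"
  show ?thesis
  proof (rule that[of q])
    have "degree q \<le> m - 1"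
      unfolding q_def
    proof (intro degree_sum_le fin finite_lessThan)
      fix n i assume "i \<in> L n"
      then have "nat \<bar>k n i\<bar> \<le> m - 1" using m by (auto simp: L_def)
      then show "degree (smult (a ^ n / fact n * real (n choose i)) (cheb (nat \<bar>k n i\<bar>))) \<le> m - 1"
        by (intro order_trans[OF degree_smult_le] order_trans[OF degree_cheb])
    qed
    then show "degree q < m" using m by simp
  next
    fix t :: real assume t: "\<bar>t\<bar> \<le> 1"
    define \<theta> where "\<theta> = arccos t"
    have ct: "cos \<theta> = t" using t unfolding \<theta>_def by (intro cos_arccos) auto
    have c: "poly (cheb (nat \<bar>j\<bar>)) t = cos (of_int j * \<theta>)" for j
      using poly_cheb_cos_int[of j \<theta>] ct by simp
    have pow: "(2 * a * t) ^ n = a ^ n * (\<Sum>i\<in>L n. real (n choose i) * cos (of_int (k n i) * \<theta>))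
        + a ^ n * (\<Sum>i\<in>H n. real (n choose i) * cos (of_int (k n i) * \<theta>))" for n
    proof -
      have "(2 * a * t) ^ n = a ^ n * (2 * cos \<theta>) ^ n" by (simp add: ct power_mult_distrib)
      also have "(2 * cos \<theta>) ^ n = (\<Sum>i\<in>L n \<union> H n. real (n choose i) * cos (of_int (k n i) * \<theta>))"
        unfolding cos_power_eq_sum fin(4) k_def ..
      also have "\<dots> = (\<Sum>i\<in>L n. real (n choose i) * cos (of_int (k n i) * \<theta>))
          + (\<Sum>i\<in>H n. real (n choose i) * cos (of_int (k n i) * \<theta>))"
        by (rule sum.union_disjoint) (rule fin)+
      finally show ?thesis by (simp add: distrib_left)
    qed
    have q: "poly q t = (\<Sum>n<N. a ^ n / fact n * (\<Sum>i\<in>L n. real (n choose i) * cos (of_int (k n i) * \<theta>)))"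
      by (simp add: q_def poly_sum c sum_distrib_left mult.assoc)
    have "\<bar>(\<Sum>n<N. (2 * a * t) ^ n / fact n) - poly q t\<bar>
        = \<bar>\<Sum>n<N. a ^ n / fact n * (\<Sum>i\<in>H n. real (n choose i) * cos (of_int (k n i) * \<theta>))\<bar>"
      by (simp add: q pow add_divide_distrib sum.distrib)
    also have "\<dots> \<le> (\<Sum>n<N. a ^ n / fact n * (2 * (r + 1 / r) ^ n / r ^ m))"
    proof (rule order_trans[OF sum_abs sum_mono])
      fix n
      have "\<bar>\<Sum>i\<in>H n. real (n choose i) * cos (of_int (k n i) * \<theta>)\<bar> \<le> (\<Sum>i\<in>H n. real (n choose i))"
        by (rule order_trans[OF sum_abs sum_mono]) (simp add: abs_mult mult_left_le)
      also have "\<dots> \<le> 2 * (r + 1 / r) ^ n / r ^ m"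
        unfolding H_def k_def by (rule binomial_tail_le[OF r])
      finally have "a ^ n / fact n * \<bar>\<Sum>i\<in>H n. real (n choose i) * cos (of_int (k n i) * \<theta>)\<bar>
          \<le> a ^ n / fact n * (2 * (r + 1 / r) ^ n / r ^ m)"
        using a by (intro mult_left_mono) auto
      then show "\<bar>a ^ n / fact n * (\<Sum>i\<in>H n. real (n choose i) * cos (of_int (k n i) * \<theta>))\<bar>
          \<le> a ^ n / fact n * (2 * (r + 1 / r) ^ n / r ^ m)"
        using a by (simp add: abs_mult)
    qed
    \<comment> \<open>Up to the factor \<open>2 / r ^ m\<close> this is a partial sum of an
      exponential series with nonnegative terms.\<close>
    also have "\<dots> = 2 / r ^ m * (\<Sum>n<N. inverse (fact n) *\<^sub>R (a * (r + 1 / r)) ^ n)"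
      unfolding sum_distrib_left
      by (intro sum.cong) (simp_all add: power_mult_distrib divide_inverse mult.left_commute)
    also have "\<dots> \<le> 2 / r ^ m * exp (a * (r + 1 / r))"
      unfolding exp_def using r a
      by (intro mult_left_mono sum_le_suminf summable_exp_generic) auto
    finally show "\<bar>exp (2 * a * t) - poly q t\<bar> \<le> 2 * exp (a * (r + 1 / r)) / r ^ m + d"
      using N[OF t] by (simp add: algebra_simps)
  qed
qed

text \<open>The affine map \<open>t = 1 + x / (2 * a)\<close> sends \<open>{- 4 * a..0}\<close> to
  \<open>[-1, 1]\<close>, and \<open>exp x = exp (- 2 * a) * exp (2 * a * t)\<close>. The factor
  \<open>exp (- 2 * a)\<close> also multiplies the error, which is why the slack is first taken as
  \<open>d * exp (2 * a)\<close>.\<close>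

lemma exp_poly_approx:
  fixes a r d :: real
  assumes a: "a > 0" and r: "r \<ge> 1" and d: "d > 0" and m: "m > 0"
  obtains q where "degree q < m"
    "\<And>x. x \<in> {- 4 * a..0} \<Longrightarrow> \<bar>exp x - poly q x\<bar> \<le> 2 * exp (a * (r + 1 / r) - 2 * a) / r ^ m + d"
proof -
  obtain q where q: "degree q < m"
    "\<And>t. \<bar>t\<bar> \<le> 1 \<Longrightarrow> \<bar>exp (2 * a * t) - poly q t\<bar>
      \<le> 2 * exp (a * (r + 1 / r)) / r ^ m + d * exp (2 * a)"
    using exp_poly_approx_unit[OF a r _ m, of "d * exp (2 * a)"] d by auto
  define p where "p = smult (exp (- 2 * a)) (pcompose q [:1, 1 / (2 * a):])"
  show ?thesis
  proof (rule that[of p])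
    have "degree p \<le> degree q"
      unfolding p_def using degree_pcompose_le[of q "[:1, 1 / (2 * a):]"] a by (simp split: if_splits)
    then show "degree p < m" using q by simp
  next
    fix x :: real assume x: "x \<in> {- 4 * a..0}"
    define t where "t = 1 + x / (2 * a)"
    have "\<bar>t\<bar> \<le> 1" using x a by (auto simp: t_def abs_le_iff field_simps)
    from q(2)[OF this] have "exp (- 2 * a) * \<bar>exp (2 * a * t) - poly q t\<bar>
        \<le> exp (- 2 * a) * (2 * exp (a * (r + 1 / r)) / r ^ m + d * exp (2 * a))"
      by (intro mult_left_mono) auto
    moreover have "exp (- 2 * a) * (exp (2 * a * t) - poly q t) = exp x - poly p x"
    proof -
      have "exp (- 2 * a) * exp (2 * a * t) = exp x" unfolding t_def using a
        by (simp flip: exp_add add: field_simps)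
      moreover have "poly p x = exp (- 2 * a) * poly q t"
        by (simp add: p_def t_def poly_pcompose)
      ultimately show ?thesis by (simp add: algebra_simps)
    qed
    then have "exp (- 2 * a) * \<bar>exp (2 * a * t) - poly q t\<bar> = \<bar>exp x - poly p x\<bar>"
      by (metis abs_mult abs_exp_cancel)
    moreover have "exp (- 2 * a) * (2 * exp (a * (r + 1 / r)) / r ^ m + d * exp (2 * a))
        = 2 * exp (a * (r + 1 / r) - 2 * a) / r ^ m + d"
      by (simp add: exp_diff exp_minus field_simps)
    ultimately show "\<bar>exp x - poly p x\<bar> \<le> 2 * exp (a * (r + 1 / r) - 2 * a) / r ^ m + d"
      by (simp only:)
  qed
qed

text \<open>The nonzero terms of the series of \<open>cosh x - 1\<close> have degree at least 2, so
  for \<open>\<bar>x\<bar> \<le> 1\<close> each is at most \<open>x\<^sup>2\<close> times its value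
  at 1. The constant bounds \<open>cosh 1 - 1\<close>, using that Euler's number lies between
  \<open>5/2\<close> and \<open>2.72\<close>.\<close>

lemma cosh_le_quadratic:
  fixes x :: real
  assumes "\<bar>x\<bar> \<le> 1"
  shows "cosh x \<le> 1 + 3/5 * x\<^sup>2"
proof -
  let ?f = "\<lambda>x n. if even n then x ^ n /\<^sub>R fact n else (0::real)"
  have s: "(\<lambda>n. ?f x (n + 2)) sums (cosh x - 1)" for x :: real
    using sums_split_initial_segment[OF cosh_converges[of x], of 2]
    by (simp add: numeral_2_eq_2 lessThan_Suc)
  have "cosh x - 1 \<le> x\<^sup>2 * (cosh 1 - 1)"
  proof (rule sums_le[OF _ s sums_mult[OF s]])
    fix n
    have "x ^ n \<le> 1" if "even n" using assms that
      by (metis abs_ge_zero power_even_abs power_le_one)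
    then have "x ^ n * x\<^sup>2 \<le> 1 * x\<^sup>2" if "even n" using that by (intro mult_right_mono) auto
    then have le: "x ^ (n + 2) \<le> x\<^sup>2" if "even n" using that by (simp only: power_add mult_1)
    show "?f x (n + 2) \<le> x\<^sup>2 * ?f 1 (n + 2)"
    proof (cases "even n")
      case True
      then have "inverse (fact (n + 2)) * x ^ (n + 2) \<le> inverse (fact (n + 2)) * x\<^sup>2"
        using le by (intro mult_left_mono) auto
      then have "x ^ (n + 2) /\<^sub>R fact (n + 2) \<le> x\<^sup>2 * (1 ^ (n + 2) /\<^sub>R fact (n + 2))"
        by (simp only: real_scaleR_def power_one mult_1_right mult.commute[of "inverse _"])
      with True show ?thesis by (simp only: even_add even_numeral simp_thms if_True)
    qed simp
  qed
  also have "cosh (1::real) - 1 \<le> 3/5"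
  proof -
    have "exp (1::real) \<ge> 5/2" using exp_lower_Taylor_quadratic[of 1] by simp
    then have "exp (-1::real) \<le> 2/5" by (simp add: exp_minus field_simps)
    then show ?thesis using e_less_272 by (simp add: cosh_def exp_minus)
  qed
  finally show ?thesis by (simp add: algebra_simps mult_right_mono)
qed

text \<open>For \<open>r = exp t\<close> the exponent is
  \<open>2 * a * (cosh t - 1) - t * M\<close>. The choice \<open>t = M / (2 * a)\<close> minimizes
  its quadratic approximation \<open>a * t\<^sup>2 - t * M\<close> and lies in
  \<open>[0, 1]\<close>. With the constant \<open>3/5\<close> of \<open>cosh_le_quadratic\<close>
  the coefficient of \<open>M\<^sup>2 / a\<close> is \<open>3/10 - 1/2 = - 1/5\<close>.\<close>

lemma Chernoff_small:
  fixes a M :: real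
  assumes "a > 0" "0 < M" "M \<le> 2 * a"
  shows "exp (a * (exp (M / (2 * a)) + 1 / exp (M / (2 * a))) - 2 * a) / exp (M / (2 * a)) powr M
     \<le> exp (- (M\<^sup>2) / (5 * a))"
proof -
  let ?t = "M / (2 * a)"
  have "cosh ?t \<le> 1 + 3/5 * ?t\<^sup>2"
    using assms by (intro cosh_le_quadratic) (simp add: abs_le_iff field_simps)
  then have "2 * a * cosh ?t \<le> 2 * a * (1 + 3/5 * ?t\<^sup>2)" using assms by (intro mult_left_mono) auto
  then have "2 * a * cosh ?t - 2 * a - ?t * M \<le> 2 * a * (3/5 * ?t\<^sup>2) - ?t * M" by (simp add: algebra_simps)
  also have "\<dots> = - (M\<^sup>2) / (5 * a)" using assms by (simp add: field_simps power2_eq_square)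
  finally have "exp (2 * a * cosh ?t - 2 * a - ?t * M) \<le> exp (- (M\<^sup>2) / (5 * a))" by simp
  moreover have "exp ?t + 1 / exp ?t = 2 * cosh ?t"
    by (simp only: cosh_field_def exp_minus inverse_eq_divide) simp
  then have "a * (exp ?t + 1 / exp ?t) = 2 * a * cosh ?t" by (simp only: mult.assoc mult.left_commute)
  moreover have "exp ?t powr M = exp (?t * M)" by (simp only: powr_def exp_not_eq_zero if_False ln_exp mult.commute)
  ultimately show ?thesis by (simp only: exp_diff)
qed

text \<open>The choice \<open>r = m / a\<close> minimizes the dominant factor
  \<open>exp (a * r) / r ^ m\<close>. The remaining summand \<open>a / r = a\<^sup>2 / m\<close> of
  the exponent is at most \<open>a / 2\<close>.\<close>

lemma Chernoff_large:
  fixes a :: real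
  assumes "a > 0" "m > 0" "2 * a \<le> real m"
  shows "exp (a * (m / a + 1 / (m / a)) - 2 * a) / (m / a) ^ m
    \<le> exp (- 3/2 * a) * (exp 1 * a / m) ^ m"
proof -
  have "a * (m / a + 1 / (m / a)) - 2 * a \<le> real m - 3/2 * a"
    using assms by (simp add: field_simps)
  then have "exp (a * (m / a + 1 / (m / a)) - 2 * a) \<le> exp (real m - 3/2 * a)" by simp
  then have "exp (a * (m / a + 1 / (m / a)) - 2 * a) / (m / a) ^ m \<le> exp (real m - 3/2 * a) / (m / a) ^ m"
    using assms by (intro divide_right_mono) auto
  also have "exp (real m - 3/2 * a) = exp (- 3/2 * a) * exp (real m)"
    by (simp flip: exp_add)
  also have "exp (real m) = exp 1 ^ m" using exp_of_nat_mult[of m "1::real"] by simp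
  finally show ?thesis by (simp add: power_mult_distrib power_divide)
qed

text \<open>Trades the surplus decay \<open>exp (- a / 2)\<close> of \<open>Chernoff_large\<close>
  for the factor \<open>1 / a\<close> of the bound to be proved.\<close>

lemma times_exp_minus_half_le:
  fixes a :: real
  assumes "a > 0"
  shows "a * exp (- 3/2 * a) \<le> 2 * exp (- a)"
proof -
  have "a \<le> 2 * exp (a / 2)" using exp_ge_add_one_self[of "a / 2"] by linarith
  then have "a * exp (- 3/2 * a) \<le> 2 * exp (a / 2) * exp (- 3/2 * a)" by (intro mult_right_mono) auto
  also have "\<dots> = 2 * exp (- a)" by (simp flip: exp_add)
  finally show ?thesis .
qed

section \<open>Spectral theorem for Hermitian matrices\<close>

lemma ctranspose_ctranspose [simp]: "ctranspose (ctranspose A) = A"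
  by (simp add: ctranspose_def vec_eq_iff)

lemma ctranspose_mult: "ctranspose (A ** B) = ctranspose B ** ctranspose A"
  by (simp add: ctranspose_def matrix_matrix_mult_def vec_eq_iff mult.commute)

lemma ctranspose_scaleR: "ctranspose (c *\<^sub>R A) = c *\<^sub>R ctranspose A"
  by (simp add: ctranspose_def vec_eq_iff)

lemma cdot_ctranspose: "cdot (ctranspose A *v x) y = cdot x (A *v y)"
proof -
  have "cdot (ctranspose A *v x) y = (\<Sum>i\<in>UNIV. \<Sum>k\<in>UNIV. cnj (x $ k) * (A $ k $ i * y $ i))"
    by (simp add: cdot_def matrix_vector_mult_def ctranspose_def sum_distrib_left sum_distrib_right ac_simps)
  also have "\<dots> = cdot x (A *v y)"
    by (subst sum.swap) (simp add: cdot_def matrix_vector_mult_def sum_distrib_left)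
  finally show ?thesis .
qed

lemma cdot_add_right: "cdot x (y + z) = cdot x y + cdot x z"
  by (simp add: cdot_def algebra_simps sum.distrib)

lemma cdot_add_left: "cdot (x + y) z = cdot x z + cdot y z"
  by (simp add: cdot_def algebra_simps sum.distrib)

lemma cdot_smult_left: "cdot (c *s x) y = cnj c * cdot x y"
  by (simp add: cdot_def sum_distrib_left mult.assoc)

lemma norm_matrix_square: "(norm (M :: complex^'k^'n))\<^sup>2 = (\<Sum>i\<in>UNIV. \<Sum>j\<in>UNIV. (cmod (M $ i $ j))\<^sup>2)"
  by (simp add: norm_vec_def L2_set_def sum_nonneg)

lemma norm_matrix_square_columns:
  "(norm (M :: complex^'k^'n))\<^sup>2 = (\<Sum>j\<in>UNIV. (norm (column j M))\<^sup>2)"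
  unfolding norm_matrix_square
  by (subst sum.swap) (simp add: norm_vec_def L2_set_def sum_nonneg column_def)

lemma norm_ctranspose [simp]: "norm (ctranspose M) = norm M"
proof -
  have "(norm (ctranspose M))\<^sup>2 = (norm M)\<^sup>2"
    unfolding norm_matrix_square by (subst sum.swap) (simp add: ctranspose_def)
  then show ?thesis by simp
qed

lemma norm_isometry:
  assumes "ctranspose V ** V = mat 1"
  shows "norm (V *v x) = norm x"
proof -
  have "cdot (V *v x) (V *v x) = cdot x x"
    by (metis assms cdot_ctranspose matrix_vector_mul_assoc matrix_vector_mul_lid ctranspose_ctranspose)
  then have "complex_of_real ((norm (V *v x))\<^sup>2) = of_real ((norm x)\<^sup>2)" unfolding cdot_self .
  then have "(norm (V *v x))\<^sup>2 = (norm x)\<^sup>2" by (simp only: of_real_eq_iff)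
  then show ?thesis by simp
qed

lemma column_mult: "column j (A ** B) = A *v column j B"
  by (simp add: column_def matrix_matrix_mult_def matrix_vector_mult_def vec_eq_iff)

lemma norm_isometry_mult:
  assumes "ctranspose V ** V = mat 1"
  shows "norm (V ** X) = norm (X :: complex^'k^'m)"
proof -
  have "(norm (V ** X))\<^sup>2 = (norm X)\<^sup>2"
    unfolding norm_matrix_square_columns by (simp add: column_mult norm_isometry[OF assms])
  then show ?thesis by simp
qed

lemma norm_mult_isometry:
  assumes "ctranspose W ** W = mat 1"
  shows "norm (X ** ctranspose W) = norm (X :: complex^'m^'k)"
  using norm_isometry_mult[OF assms, of "ctranspose X"]
  by (metis ctranspose_ctranspose ctranspose_mult norm_ctranspose)

lemma norm_matrix_vector_le: "norm ((M :: complex^'k^'n) *v x) \<le> norm M * norm x"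
proof -
  have "cmod ((M *v x) $ i) \<le> norm (M $ i) * norm x" for i
  proof -
    have "cmod ((M *v x) $ i) \<le> (\<Sum>j\<in>UNIV. \<bar>cmod (M $ i $ j)\<bar> * \<bar>cmod (x $ j)\<bar>)"
      unfolding matrix_vector_mult_def by (simp add: order_trans[OF norm_sum] norm_mult)
    also have "\<dots> \<le> norm (M $ i) * norm x" unfolding norm_vec_def by (rule L2_set_mult_ineq)
    finally show ?thesis .
  qed
  then have "norm (M *v x) \<le> L2_set (\<lambda>i. norm (M $ i) * norm x) UNIV"
    unfolding norm_vec_def[of "M *v x"] by (intro L2_set_mono) auto
  also have "\<dots> = norm M * norm x" by (simp add: norm_vec_def[of M] L2_set_left_distrib)
  finally show ?thesis .
qed

text \<open>Errors are estimated in the Frobenius norm, which isometries and unitary changes of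
  basis preserve; this is the passage to the 2-norm. By \<open>norm_outer\<close> the direction has
  Frobenius norm exactly \<open>norm y * norm z\<close>.\<close>

lemma spectral_norm_le_norm: "spectral_norm M \<le> norm M"
  unfolding spectral_norm_def by (rule onorm_le) (rule norm_matrix_vector_le)

lemma norm_matrix_mult_le: "norm ((A :: complex^'m^'n) ** (B :: complex^'k^'m)) \<le> norm A * norm B"
proof (rule power2_le_imp_le)
  have "(norm (A ** B))\<^sup>2 \<le> (\<Sum>j\<in>UNIV. (norm A * norm (column j B))\<^sup>2)"
    unfolding norm_matrix_square_columns column_mult
    by (intro sum_mono power_mono norm_matrix_vector_le) auto
  also have "\<dots> = (norm A * norm B)\<^sup>2"
    by (simp add: power_mult_distrib norm_matrix_square_columns[of B] sum_distrib_left)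
  finally show "(norm (A ** B))\<^sup>2 \<le> (norm A * norm B)\<^sup>2" .
qed simp

lemma norm_outer: "norm (outer y z) = norm y * norm z"
proof -
  have "(norm (outer y z))\<^sup>2 = (norm y * norm z)\<^sup>2"
    unfolding norm_matrix_square power_mult_distrib
    by (simp add: outer_def norm_mult power_mult_distrib norm_vec_def L2_set_def sum_nonneg sum_product)
  then show ?thesis by simp
qed

lemma outer_mult: "A ** outer x y ** ctranspose B = outer (A *v x) (B *v y)"
proof -
  have "(A ** outer x y ** ctranspose B) $ i $ j = (\<Sum>k\<in>UNIV. (\<Sum>l\<in>UNIV. A $ i $ l * (x $ l * cnj (y $ k))) * cnj (B $ j $ k))" for i j
    by (simp add: matrix_matrix_mult_def outer_def ctranspose_def)
  also have "\<dots> i j = (\<Sum>l\<in>UNIV. A $ i $ l * x $ l) * (\<Sum>k\<in>UNIV. cnj (B $ j $ k) * cnj (y $ k))" for i j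
    by (subst mult.commute) (simp add: sum_distrib_right sum_distrib_left ac_simps)
  finally show ?thesis by (simp add: vec_eq_iff outer_def matrix_vector_mult_def)
qed

lemma outer_scaleR: "outer (c *\<^sub>R x) (d *\<^sub>R y) = (c * d) *\<^sub>R outer x y"
  by (simp add: outer_def vec_eq_iff)

section \<open>Eigenvectors of Hermitian matrices\<close>

lemma hermitian_cdot: "hermitian A \<Longrightarrow> cdot (A *v x) y = cdot x (A *v y)"
  using cdot_ctranspose[of A x y] by (simp add: hermitian_def)

text \<open>The eigenvector is a maximizer \<open>v\<close> of the quadratic form on the unit sphere
  of \<open>T\<close>. The residual \<open>w = A *v v - \<mu> *\<^sub>R v\<close> lies in
  \<open>T\<close>; if it were nonzero, moving from \<open>v\<close> a little in direction
  \<open>w\<close> would raise the Rayleigh quotient above its maximum.\<close>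

lemma hermitian_eigenvector:
  fixes A :: "complex^'n^'n"
  assumes herm: "hermitian A" and T: "vec.subspace T" and x: "x \<in> T" "x \<noteq> 0"
    and inv: "\<And>x. x \<in> T \<Longrightarrow> A *v x \<in> T"
  obtains v \<mu> where "v \<in> T" "cdot v v = 1" "A *v v = of_real \<mu> *s v"
proof -
  define f where "f x = Re (cdot x (A *v x))" for x
  have subR: "c *\<^sub>R x \<in> T" if "x \<in> T" for c x
    using T that by (simp add: scaleR_eq_smult vec.subspace_scale)
  have add: "x + y \<in> T" if "x \<in> T" "y \<in> T" for x y
    using T that by (simp add: vec.subspace_add)
  have "subspace T" using T add subR by (auto simp: subspace_def vec.subspace_0)
  then have "compact (sphere 0 1 \<inter> T)"
    by (intro compact_Int_closed closed_subspace) auto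
  moreover have "x /\<^sub>R norm x \<in> sphere 0 1 \<inter> T" using x subR by simp
  moreover have "continuous_on (sphere 0 1 \<inter> T) f"
    unfolding f_def cdot_def matrix_vector_mult_def vec_lambda_beta by (intro continuous_intros)
  ultimately obtain v where v: "norm v = 1" "v \<in> T" and max: "\<And>y. norm y = 1 \<Longrightarrow> y \<in> T \<Longrightarrow> f y \<le> f v"
    using continuous_attains_sup[of "sphere 0 1 \<inter> T" f] by (metis IntD1 IntD2 IntI empty_iff mem_sphere_0)
  define \<mu> where "\<mu> = f v"
  have f_le: "f y \<le> \<mu> * (norm y)\<^sup>2" if "y \<in> T" for y
  proof (cases "y = 0")
    case False
    have "f (y /\<^sub>R norm y) \<le> \<mu>" unfolding \<mu>_def using False that subR by (intro max) auto
    moreover have "f (y /\<^sub>R norm y) = f y / (norm y)\<^sup>2"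
      unfolding f_def scaleR_eq_smult vector_scalar_commute cdot_smult_left cdot_simps
      using False by (simp add: power2_eq_square divide_inverse) (simp add: field_simps)
    ultimately have "f y / (norm y)\<^sup>2 \<le> \<mu>" by simp
    then show ?thesis using False by (simp add: pos_divide_le_eq)
  qed (simp add: f_def cdot_simps)
  define w where "w = A *v v - \<mu> *\<^sub>R v"
  have w: "w \<in> T" using v inv subR T by (simp add: w_def vec.subspace_diff)
  have "w = 0"
  proof (rule ccontr)
    assume "w \<noteq> 0"
    define c where "c = \<mu> * (norm w)\<^sup>2 - f w"
    \<comment> \<open>Maximality will give \<open>2 * (norm w)\<^sup>2 \<le> t * c\<close>, whereas
      this \<open>t\<close> makes the right side at most \<open>(norm w)\<^sup>2\<close>. The
      summand 1 keeps the denominator positive.\<close>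
    define t where "t = (norm w)\<^sup>2 / (\<bar>c\<bar> + 1)"
    have t: "t > 0" using \<open>w \<noteq> 0\<close> by (simp add: t_def divide_pos_pos)
    have e1: "f (v + t *\<^sub>R w) = \<mu> + 2 * t * Re (cdot w (A *v v)) + t\<^sup>2 * f w"
    proof -
      have "Re (cdot v (A *v w)) = Re (cdot w (A *v v))"
        using hermitian_cdot[OF herm, of v w] cdot_commute[of "A *v v" w] by (metis cdot_commute cnj.sel(1))
      then show ?thesis
        unfolding f_def \<mu>_def scaleR_eq_smult matrix_vector_right_distrib vector_scalar_commute
          cdot_add_left cdot_add_right cdot_smult_left cdot_simps
        by (simp add: power2_eq_square algebra_simps)
    qed
    have e2: "(norm (v + t *\<^sub>R w))\<^sup>2 = 1 + 2 * t * Re (cdot w v) + t\<^sup>2 * (norm w)\<^sup>2"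
    proof -
      have n: "(norm x)\<^sup>2 = Re (cdot x x)" for x :: "complex^'n" by (simp add: cdot_self)
      have "Re (cdot v w) = Re (cdot w v)" using cdot_commute[of v w] by simp
      moreover have "Re (cdot v v) = 1" using v n[of v] by simp
      ultimately show ?thesis
        unfolding n scaleR_eq_smult cdot_add_left cdot_add_right cdot_smult_left cdot_simps
        by (simp add: power2_eq_square algebra_simps)
    qed
    have "f (v + t *\<^sub>R w) \<le> \<mu> * (norm (v + t *\<^sub>R w))\<^sup>2"
      by (intro f_le add subR v w)
    then have "2 * t * (Re (cdot w (A *v v)) - \<mu> * Re (cdot w v)) \<le> t * (t * c)"
      unfolding e1 e2 c_def by (simp add: algebra_simps power2_eq_square)
    moreover have "Re (cdot w (A *v v)) - \<mu> * Re (cdot w v) = (norm w)\<^sup>2"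
    proof -
      have "(norm w)\<^sup>2 = Re (cdot w w)" by (simp add: cdot_self)
      also have "\<dots> = Re (cdot w (A *v v)) - \<mu> * Re (cdot w v)"
        by (subst (2) w_def) (simp add: cdot_simps)
      finally show ?thesis ..
    qed
    ultimately have "t * (2 * (norm w)\<^sup>2) \<le> t * (t * c)" by (simp add: mult.assoc mult.left_commute)
    then have "2 * (norm w)\<^sup>2 \<le> t * c" using t by simp
    also have "t * c \<le> t * (\<bar>c\<bar> + 1)" using t by (intro mult_left_mono) auto
    also have "\<dots> = (norm w)\<^sup>2" by (simp add: t_def add_nonneg_pos[THEN less_imp_neq[THEN not_sym]])
    finally show False using \<open>w \<noteq> 0\<close> by simp
  qed
  then have "A *v v = of_real \<mu> *s v" by (simp add: w_def scaleR_eq_smult)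
  moreover have "cdot v v = 1" using v by (simp add: cdot_self)
  ultimately show ?thesis using that v by blast
qed

text \<open>The next eigenvector is found in the orthogonal complement \<open>T\<close> of the
  previous ones, which is invariant because \<open>A\<close> is Hermitian, and nonzero because fewer
  than \<open>CARD('n)\<close> vectors cannot span the space.\<close>

lemma hermitian_orthonormal_eigenvectors:
  fixes A :: "complex^'n^'n"
  assumes herm: "hermitian A" and "k \<le> CARD('n)"
  shows "\<exists>u \<mu>. (\<forall>i<k. A *v u i = complex_of_real (\<mu> i) *s u i) \<and>
    (\<forall>i<k. \<forall>j<k. cdot (u i) (u j) = (if i = j then 1 else 0))"
  using assms(2)
proof (induction k)
  case (Suc k)
  then obtain u \<mu> where eig: "\<And>i. i < k \<Longrightarrow> A *v u i = complex_of_real (\<mu> i) *s u i"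
    and orth: "\<And>i j. i < k \<Longrightarrow> j < k \<Longrightarrow> cdot (u i) (u j) = (if i = j then 1 else 0)"
    by (metis Suc_leD)
  define T where "T = {x. \<forall>i<k. cdot (u i) x = 0}"
  have T: "vec.subspace T"
    by (auto simp: T_def vec.subspace_def cdot_simps cdot_add_right)
  have "vec.dim (vec.span (u ` {..<k})) \<le> card {..<k}"
    using vec.dim_le_card[of "vec.span (u ` {..<k})" "u ` {..<k}"] card_image_le[of "{..<k}" u] by simp
  then have "vec.span (u ` {..<k}) \<noteq> UNIV" using Suc.prems
    by (metis Suc_n_not_le_n card_lessThan card_cart_basis le_trans vec.dim_UNIV vec_dim_card)
  then obtain x where x: "x \<notin> vec.span (u ` {..<k})" by blast
  \<comment> \<open>The orthogonal projection of \<open>x\<close> onto the span, so that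
    \<open>x - p\<close> is a nonzero element of \<open>T\<close>.\<close>
  define p where "p = (\<Sum>i<k. cdot (u i) x *s u i)"
  have "x - p \<noteq> 0"
  proof
    assume "x - p = 0"
    then have "x = p" by simp
    also have "p \<in> vec.span (u ` {..<k})"
      unfolding p_def by (intro vec.span_sum vec.span_scale vec.span_base) auto
    finally show False using x by simp
  qed
  moreover have "x - p \<in> T"
    unfolding T_def p_def
    by (auto simp: cdot_simps cdot_sum orth if_distrib[of "(*) _"] cong: if_cong)
  moreover have "A *v v \<in> T" if "v \<in> T" for v
    using that eig hermitian_cdot[OF herm] unfolding T_def
    by (simp flip: hermitian_cdot[OF herm] add: cdot_smult_left)
  ultimately obtain v \<nu> where v: "v \<in> T" "cdot v v = 1" "A *v v = complex_of_real \<nu> *s v"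
    using hermitian_eigenvector[OF herm T] by metis
  have uv: "cdot (u i) v = 0" "cdot v (u i) = 0" if "i < k" for i
    using v(1) that cdot_commute[of v "u i"] by (auto simp: T_def)
  show ?case
    by (rule exI[of _ "u(k := v)"], rule exI[of _ "\<mu>(k := \<nu>)"])
      (auto simp: less_Suc_eq eig orth uv v)
qed simp

definition diag :: "('n \<Rightarrow> complex) \<Rightarrow> complex^'n^'n" where
  "diag d = (\<chi> i j. if i = j then d i else 0)"

lemma mult_diag: "(M ** diag d) $ i $ j = M $ i $ j * d j"
  by (simp add: matrix_matrix_mult_def diag_def if_distrib[of "(*) _"] cong: if_cong)

lemma diag_mult: "(diag d ** M) $ i $ j = d i * M $ i $ j"
  by (simp add: matrix_matrix_mult_def diag_def if_distrib[of "\<lambda>x. x * _"] cong: if_cong)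

definition unitary_diagonalization ::
    "complex^'n^'n \<Rightarrow> complex^'n^'n \<Rightarrow> ('n \<Rightarrow> real) \<Rightarrow> bool" where
  "unitary_diagonalization A U a \<longleftrightarrow>
     ctranspose U ** U = mat 1 \<and> U ** ctranspose U = mat 1 \<and>
     A = U ** diag (\<lambda>i. of_real (a i)) ** ctranspose U"

lemma hermitian_diagonalization:
  fixes A :: "complex^'n^'n"
  assumes "hermitian A"
  obtains U a where "unitary_diagonalization A U a"
proof -
  obtain u \<mu> where eig: "\<And>i. i < CARD('n) \<Longrightarrow> A *v u i = complex_of_real (\<mu> i) *s u i"
    and orth: "\<And>i j. i < CARD('n) \<Longrightarrow> j < CARD('n) \<Longrightarrow> cdot (u i) (u j) = (if i = j then 1 else 0)"
    using hermitian_orthonormal_eigenvectors[OF assms order_refl] by metis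
  \<comment> \<open>The eigenvectors are numbered by naturals, the columns of \<open>U\<close> by
    the index type.\<close>
  obtain h where h: "bij_betw h (UNIV :: 'n set) {..<CARD('n)}"
    using finite_same_card_bij[of "UNIV :: 'n set" "{..<CARD('n)}"] by auto
  then have hlt: "h i < CARD('n)" and hinj: "h i = h j \<longleftrightarrow> i = j" for i j
    by (auto simp: bij_betw_def inj_on_def)
  define U :: "complex^'n^'n" where "U = (\<chi> i j. u (h j) $ i)"
  have UU: "ctranspose U ** U = mat 1"
    using orth[OF hlt hlt] hinj
    by (simp add: vec_eq_iff matrix_matrix_mult_def ctranspose_def U_def mat_def cdot_def)
  then have UU': "U ** ctranspose U = mat 1" by (rule matrix_left_right_inverse1)
  have col: "column j U = u (h j)" for j by (simp add: U_def column_def vec_eq_iff)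
  have "A ** U = U ** diag (\<lambda>i. of_real (\<mu> (h i)))"
  proof -
    have "column j (A ** U) $ i = (U ** diag (\<lambda>i. of_real (\<mu> (h i)))) $ i $ j" for i j
      unfolding column_mult col by (simp add: eig[OF hlt] mult_diag U_def)
    then show ?thesis by (simp add: vec_eq_iff column_def)
  qed
  then have "A = U ** diag (\<lambda>i. of_real (\<mu> (h i))) ** ctranspose U"
    by (metis UU' matrix_mul_assoc matrix_mul_rid)
  with UU UU' have "unitary_diagonalization A U (\<lambda>i. \<mu> (h i))"
    unfolding unitary_diagonalization_def by blast
  then show ?thesis by (rule that)
qed

lemma unitary_diagonalization_spectrum:
  assumes "unitary_diagonalization A U a"
  shows "complex_of_real (a i) \<in> spectrum A"
proof -
  have "ctranspose U ** U = mat 1" and A: "A = U ** diag (\<lambda>i. of_real (a i)) ** ctranspose U"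
    using assms by (auto simp: unitary_diagonalization_def)
  then have AU: "A ** U = U ** diag (\<lambda>i. of_real (a i))"
    by (simp flip: matrix_mul_assoc)
  have "A *v column i U = complex_of_real (a i) *s column i U"
    unfolding column_mult[symmetric] AU by (simp add: vec_eq_iff column_def mult_diag mult.commute)
  moreover have "column i U \<noteq> 0"
  proof
    assume "column i U = 0"
    then have "column i (ctranspose U ** U) $ i = 0" unfolding column_mult by simp
    then show False using \<open>ctranspose U ** U = mat 1\<close> by (simp add: column_def mat_def)
  qed
  ultimately show ?thesis unfolding spectrum_def by blast
qed

section \<open>Divided differences and double operator integrals\<close>

text \<open>For diagonalizations \<open>(U, a)\<close> of \<open>A\<close> and \<open>(W, b)\<close> of \<open>B\<close> this is the double operator
  integral: the linear extension of \<open>f x * g y \<mapsto> f(A) E g(B)\<close> to arbitrary kernels.\<close>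

definition dop :: "complex^'n^'n \<Rightarrow> ('n \<Rightarrow> real) \<Rightarrow> complex^'k^'k \<Rightarrow> ('k \<Rightarrow> real) \<Rightarrow>
    (real \<Rightarrow> real \<Rightarrow> complex) \<Rightarrow> complex^'k^'n \<Rightarrow> complex^'k^'n" where
  "dop U a W b \<phi> E =
     U ** (\<chi> i j. \<phi> (a i) (b j) * (ctranspose U ** E ** W) $ i $ j) ** ctranspose W"

lemma dop_entry:
  "dop U a W b \<phi> E $ i $ j = (\<Sum>l\<in>UNIV. \<Sum>k\<in>UNIV.
     \<phi> (a k) (b l) * (U $ i $ k * (ctranspose U ** E ** W) $ k $ l * cnj (W $ j $ l)))"
  unfolding dop_def matrix_matrix_mult_def[of _ "ctranspose W"]
    matrix_matrix_mult_def[of U "\<chi> i j. _ i j"] vec_lambda_beta sum_distrib_right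
  by (simp add: ctranspose_def ac_simps)

lemma dop_diff: "dop U a W b (\<lambda>x y. \<phi> x y - \<psi> x y) E = dop U a W b \<phi> E - dop U a W b \<psi> E"
  by (simp add: vec_eq_iff dop_entry algebra_simps sum_subtractf)

lemma dop_sum: "dop U a W b (\<lambda>x y. \<Sum>k\<in>I. \<phi> k x y) E = (\<Sum>k\<in>I. dop U a W b (\<phi> k) E)"
proof (induction I rule: infinite_finite_induct)
  case (insert k I)
  then show ?case
    by (simp add: vec_eq_iff dop_entry distrib_right sum.distrib flip: insert(3))
qed (simp_all add: vec_eq_iff dop_entry)

lemma dop_scaleR: "dop U a W b (\<lambda>x y. of_real c * \<phi> x y) E = c *\<^sub>R dop U a W b \<phi> E"
  unfolding vec_eq_iff vector_scaleR_component dop_entry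
  by (simp add: scaleR_conv_of_real sum_distrib_left mult.assoc)

text \<open>Each entry of \<open>dop\<close> is a finite combination of kernel values at pairs of
  eigenvalues, so convergence at these pairs suffices.\<close>

lemma dop_sums:
  assumes "\<And>i j. (\<lambda>k. \<phi> k (a i) (b j)) sums \<psi> (a i) (b j)"
  shows "(\<lambda>k. dop U a W b (\<phi> k) E) sums dop U a W b \<psi> E"
proof -
  have "(\<lambda>n. dop U a W b (\<lambda>x y. \<Sum>k<n. \<phi> k x y) E) \<longlonglongrightarrow> dop U a W b \<psi> E"
    unfolding dop_entry by (intro vec_tendstoI) (unfold dop_entry, intro tendsto_intros assms[unfolded sums_def])
  then show ?thesis by (simp add: sums_def dop_sum)
qed

text \<open>In the two eigenbases \<open>dop\<close> multiplies the entries of the matrix by kernel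
  values, and the Frobenius norm is unitarily invariant.\<close>

lemma norm_dop_le:
  assumes "unitary_diagonalization A U a" "unitary_diagonalization B W b"
    and "\<And>i j. cmod (\<phi> (a i) (b j)) \<le> C"
  shows "norm (dop U a W b \<phi> E) \<le> C * norm E"
proof -
  have U: "ctranspose U ** U = mat 1" "ctranspose (ctranspose U) ** ctranspose U = mat 1"
    and W: "ctranspose W ** W = mat 1" "ctranspose (ctranspose W) ** ctranspose W = mat 1"
    using assms by (auto simp: unitary_diagonalization_def)
  have C: "C \<ge> 0" using assms(3) norm_ge_zero order_trans by blast
  let ?F = "ctranspose U ** E ** W"
  have "norm (dop U a W b \<phi> E) = norm (\<chi> i j. \<phi> (a i) (b j) * ?F $ i $ j)"
    unfolding dop_def by (simp only: norm_isometry_mult[OF U(1)] norm_mult_isometry[OF W(1)])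
  also have "\<dots> \<le> C * norm ?F"
  proof (rule power2_le_imp_le)
    have "(cmod (\<phi> (a i) (b j) * ?F $ i $ j))\<^sup>2 \<le> C\<^sup>2 * (cmod (?F $ i $ j))\<^sup>2" for i j
      unfolding norm_mult power_mult_distrib using assms(3) by (intro mult_right_mono power_mono) auto
    then show "(norm (\<chi> i j. \<phi> (a i) (b j) * ?F $ i $ j))\<^sup>2 \<le> (C * norm ?F)\<^sup>2"
      unfolding norm_matrix_square power_mult_distrib sum_distrib_left vec_lambda_beta
      by (intro sum_mono)
  qed (use C in simp)
  also have "norm ?F = norm E"
    using norm_mult_isometry[OF W(2), of "ctranspose U ** E"] norm_isometry_mult[OF U(2), of E] by simp
  finally show ?thesis .
qed

section \<open>Matrix powers in an eigenbasis\<close>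

lemma mpow_0 [simp]: "mpow A 0 = mat 1"
  by (simp add: mpow_def)

lemma mpow_Suc: "mpow A (Suc k) = A ** mpow A k"
  by (simp add: mpow_def)

lemma mpow_mult_vec: "mpow A k *v x = (((*v) A) ^^ k) x"
  by (induction k) (simp_all add: mpow_Suc flip: matrix_vector_mul_assoc)

lemma mpow_unitary_diagonalization:
  assumes "unitary_diagonalization A U a"
  shows "mpow A k = U ** diag (\<lambda>i. of_real (a i) ^ k) ** ctranspose U"
proof (induction k)
  case 0
  have "diag (\<lambda>i. 1) = (mat 1 :: complex^'a^'a)" by (simp add: diag_def mat_def)
  then show ?case using assms by (simp add: unitary_diagonalization_def)
next
  case (Suc k)
  have U: "ctranspose U ** U = mat 1" and A: "A = U ** diag (\<lambda>i. of_real (a i)) ** ctranspose U"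
    using assms by (auto simp: unitary_diagonalization_def)
  have "mpow A (Suc k) = U ** diag (\<lambda>i. of_real (a i)) ** (ctranspose U ** U)
      ** diag (\<lambda>i. of_real (a i) ^ k) ** ctranspose U"
    unfolding mpow_Suc Suc by (subst A) (simp only: matrix_mul_assoc)
  also have "U ** diag (\<lambda>i. of_real (a i)) ** (ctranspose U ** U) ** diag (\<lambda>i. of_real (a i) ^ k)
      = U ** (diag (\<lambda>i. of_real (a i)) ** diag (\<lambda>i. of_real (a i) ^ k))"
    by (simp add: U matrix_mul_assoc)
  also have "diag (\<lambda>i. of_real (a i)) ** diag (\<lambda>i. of_real (a i) ^ k) = diag (\<lambda>i. of_real (a i) ^ Suc k)"
    by (simp add: vec_eq_iff diag_mult) (simp add: diag_def)
  finally show ?case .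
qed

lemma dop_product:
  "dop U a W b (\<lambda>x y. f x * g y) E =
     (U ** diag (\<lambda>i. f (a i)) ** ctranspose U) ** E ** (W ** diag (\<lambda>i. g (b i)) ** ctranspose W)"
proof -
  have "(\<chi> i j. f (a i) * g (b j) * (ctranspose U ** E ** W) $ i $ j)
      = diag (\<lambda>i. f (a i)) ** (ctranspose U ** E ** W) ** diag (\<lambda>i. g (b i))"
    by (simp add: vec_eq_iff diag_mult mult_diag mult.commute mult.left_commute)
  then show ?thesis by (simp only: dop_def matrix_mul_assoc)
qed

lemma dop_monomial:
  assumes "unitary_diagonalization A U a" "unitary_diagonalization B W b"
  shows "dop U a W b (\<lambda>x y. of_real x ^ i * of_real y ^ j) E = mpow A i ** E ** mpow B j"
  unfolding dop_product assms[THEN mpow_unitary_diagonalization] ..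

definition exp_dd :: "real \<Rightarrow> real \<Rightarrow> real" where
  "exp_dd x y = (if x = y then exp x else (exp x - exp y) / (x - y))"

text \<open>The inner sum is the divided difference of the monomial of degree \<open>k\<close>; the
  exponential series is treated term by term.\<close>

lemma exp_dd_sums: "(\<lambda>k. (1 / fact k) * (\<Sum>i<k. x ^ i * y ^ (k - 1 - i))) sums exp_dd x y"
proof (cases "x = y")
  case True
  \<comment> \<open>On the diagonal the inner sum is \<open>k * x ^ (k - 1)\<close>. It is empty for
    \<open>k = 0\<close>, so the series can start at index 1.\<close>
  have "(\<lambda>k. 1 / fact (Suc k) * (\<Sum>i<Suc k. x ^ i * x ^ (Suc k - 1 - i))) = (\<lambda>k. x ^ k /\<^sub>R fact k)"
  proof
    fix k
    have "(\<Sum>i<Suc k. x ^ i * x ^ (Suc k - 1 - i)) = (\<Sum>i<Suc k. x ^ k)"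
      by (intro sum.cong) (simp_all flip: power_add)
    then show "1 / fact (Suc k) * (\<Sum>i<Suc k. x ^ i * x ^ (Suc k - 1 - i)) = x ^ k /\<^sub>R fact k"
      by (simp add: field_simps del: of_nat_Suc)
  qed
  then have "(\<lambda>k. 1 / fact (Suc k) * (\<Sum>i<Suc k. x ^ i * x ^ (Suc k - 1 - i))) sums exp x"
    using exp_converges[of x] by simp
  from sums_Suc[OF this] show ?thesis
    unfolding True[symmetric] exp_dd_def
    by (simp only: lessThan_0 sum.empty mult_zero_right add_0_right if_True simp_thms)
next
  case False
  have p: "(\<Sum>i<k. x ^ i * y ^ (k - 1 - i)) = (x ^ k - y ^ k) / (x - y)" for k
  proof -
    have "x ^ k - y ^ k = (x - y) * (\<Sum>i<k. y ^ (k - Suc i) * x ^ i)" by (rule power_diff_sumr2)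
    then show ?thesis using False by (simp add: mult.commute)
  qed
  have "(\<lambda>k. (x ^ k /\<^sub>R fact k - y ^ k /\<^sub>R fact k) / (x - y)) sums ((exp x - exp y) / (x - y))"
    by (intro sums_divide sums_diff exp_converges)
  moreover have "1 / fact k * ((x ^ k - y ^ k) / (x - y)) = (x ^ k /\<^sub>R fact k - y ^ k /\<^sub>R fact k) / (x - y)" for k
    using False by (simp add: field_simps)
  ultimately show ?thesis unfolding p exp_dd_def using False by simp
qed

text \<open>The first divided difference of \<open>p\<close>, written without a division: it covers
  the diagonal and has the shape of the Frechet derivative of a matrix polynomial.\<close>

definition dd_poly :: "real poly \<Rightarrow> real \<Rightarrow> real \<Rightarrow> real" where
  "dd_poly p x y = (\<Sum>k\<le>degree p. coeff p k * (\<Sum>i<k. x ^ i * y ^ (k - 1 - i)))"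

lemma dd_poly_diff: "(x - y) * dd_poly p x y = poly p x - poly p y"
proof -
  have "(x - y) * (\<Sum>i<k. x ^ i * y ^ (k - 1 - i)) = x ^ k - y ^ k" for k
    by (simp add: power_diff_sumr2[of x k y] mult.commute)
  then have "(x - y) * (c * (\<Sum>i<k. x ^ i * y ^ (k - 1 - i))) = c * (x ^ k - y ^ k)" for k c
    by (metis mult.left_commute)
  then show ?thesis
    by (simp only: dd_poly_def sum_distrib_left poly_altdef right_diff_distrib sum_subtractf)
qed

lemma dd_poly_same: "dd_poly p x x = poly (pderiv p) x"
proof -
  have "dd_poly p x x = (\<Sum>k\<le>degree p. coeff p k * (of_nat k * x ^ (k - 1)))"
  proof -
    have "(\<Sum>i<k. x ^ i * x ^ (k - 1 - i)) = (\<Sum>i<k. x ^ (k - 1))" for k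
      by (intro sum.cong) (simp_all flip: power_add)
    then show ?thesis by (simp add: dd_poly_def)
  qed
  moreover have "((\<lambda>x. \<Sum>k\<le>degree p. coeff p k * x ^ k) has_real_derivative
      (\<Sum>k\<le>degree p. coeff p k * (of_nat k * x ^ (k - 1)))) (at x)"
    by (auto intro!: derivative_eq_intros sum.cong)
  then have "(poly p has_real_derivative (\<Sum>k\<le>degree p. coeff p k * (of_nat k * x ^ (k - 1)))) (at x)"
    by (simp add: poly_altdef[abs_def])
  ultimately show ?thesis using poly_DERIV DERIV_unique by metis
qed

text \<open>By the mean value theorem the divided difference of \<open>exp - p\<close> is a value of
  its derivative between \<open>x\<close> and \<open>y\<close>. Hence it is \<open>pderiv p\<close>,
  not \<open>p\<close>, that has to approximate \<open>exp\<close>.\<close>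

lemma exp_dd_dd_poly_le:
  assumes "\<And>x. x \<in> {l..u} \<Longrightarrow> \<bar>exp x - poly (pderiv p) x\<bar> \<le> C"
    and "x \<in> {l..u}" "y \<in> {l..u}"
  shows "\<bar>exp_dd x y - dd_poly p x y\<bar> \<le> C"
proof -
  have *: "\<bar>exp_dd x y - dd_poly p x y\<bar> \<le> C" if xy: "x < y" "x \<in> {l..u}" "y \<in> {l..u}" for x y
  proof -
    have "\<exists>z. x < z \<and> z < y \<and> (exp y - poly p y) - (exp x - poly p x) = (y - x) * (exp z - poly (pderiv p) z)"
      by (rule MVT2[OF xy(1)]) (auto intro!: derivative_eq_intros poly_DERIV)
    then obtain z where z: "x < z" "z < y"
      and eq: "(exp y - poly p y) - (exp x - poly p x) = (y - x) * (exp z - poly (pderiv p) z)"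
      by blast
    have "exp_dd x y - dd_poly p x y = exp z - poly (pderiv p) z"
    proof -
      have "(x - y) * (exp_dd x y - dd_poly p x y) = (x - y) * (exp z - poly (pderiv p) z)"
        unfolding right_diff_distrib[of "x - y" "exp_dd x y"] dd_poly_diff
        using xy(1) eq by (simp add: exp_dd_def) (simp add: algebra_simps)
      then show ?thesis using xy(1) by simp
    qed
    then show ?thesis using assms(1)[of z] z xy by auto
  qed
  have sym: "exp_dd x y = exp_dd y x" for x y
    by (auto simp: exp_dd_def frac_eq_eq algebra_simps)
  have sym': "dd_poly p x y = dd_poly p y x" if "x \<noteq> y" for x y
  proof -
    have "(x - y) * dd_poly p x y = (x - y) * dd_poly p y x"
      using dd_poly_diff[of x y p] dd_poly_diff[of y x p] by (simp add: algebra_simps)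
    then show ?thesis using that by simp
  qed
  consider "x < y" | "x = y" | "y < x" by linarith
  then show ?thesis
  proof cases
    case 1
    then show ?thesis using *[OF _ assms(2,3)] by simp
  next
    case 2
    then show ?thesis using assms(1)[of x] assms(2) by (simp add: dd_poly_same exp_dd_def)
  next
    case 3
    then show ?thesis using *[OF _ assms(3,2)] sym[of x y] sym'[of x y] by simp
  qed
qed

section \<open>Frechet derivative and Arnoldi core in an eigenbasis\<close>

lemma matrix_mult_scaleR_left: "(c *\<^sub>R A) ** B = c *\<^sub>R ((A :: complex^'m^'n) ** B)"
  by (simp add: scalar_matrix_assoc)

lemma matrix_mult_scaleR_right: "A ** (c *\<^sub>R B) = c *\<^sub>R ((A :: complex^'m^'n) ** B)"
  by (simp add: matrix_scalar_ac scalar_matrix_assoc)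

lemma scaleR_matrix_vector_mult: "(c *\<^sub>R A) *v x = complex_of_real c *s (A *v x)"
  unfolding vec_eq_iff matrix_vector_mult_def
  by (simp add: scaleR_conv_of_real[where 'a = complex] sum_distrib_left mult.assoc)

lemma bounded_bilinear_matrix_mult:
  "bounded_bilinear ((**) :: complex^'m^'n \<Rightarrow> complex^'k^'m \<Rightarrow> complex^'k^'n)"
proof
  fix A A' :: "complex^'m^'n" and B B' :: "complex^'k^'m" and r :: real
  show "(A + A') ** B = A ** B + A' ** B"
    by (simp add: vec_eq_iff matrix_matrix_mult_def distrib_right sum.distrib)
  show "A ** (B + B') = A ** B + A ** B'" by (rule matrix_add_ldistrib)
  show "\<exists>K. \<forall>(A :: complex^'m^'n) (B :: complex^'k^'m). norm (A ** B) \<le> norm A * norm B * K"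
    by (intro exI[of _ 1]) (simp add: norm_matrix_mult_le)
qed (simp_all only: matrix_mult_scaleR_left matrix_mult_scaleR_right)

interpretation matrix_mult: bounded_bilinear "(**) :: complex^'m^'n \<Rightarrow> complex^'k^'m \<Rightarrow> complex^'k^'n"
  by (rule bounded_bilinear_matrix_mult)

lemma dop_scaleR_right: "dop U a W b \<phi> (c *\<^sub>R E) = c *\<^sub>R dop U a W b \<phi> E"
  by (simp add: vec_eq_iff dop_entry matrix_mult_scaleR_left matrix_mult_scaleR_right scaleR_sum_right)

text \<open>For \<open>A = B = M\<close> this is the Frechet derivative of the power
  \<open>k\<close> at \<open>M\<close>. Two separate matrices are allowed because after compression
  the left and the right factor differ.\<close>

definition dmpow :: "complex^'n^'n \<Rightarrow> complex^'k^'k \<Rightarrow> nat \<Rightarrow> complex^'k^'n \<Rightarrow> complex^'k^'n" where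
  "dmpow A B k E = (\<Sum>i<k. mpow A i ** E ** mpow B (k - 1 - i))"

lemma dmpow_Suc: "dmpow A B (Suc k) E = E ** mpow B k + A ** dmpow A B k E"
  unfolding dmpow_def
  by (subst sum.lessThan_Suc_shift)
    (simp add: mpow_Suc matrix_mult.sum_right matrix_mul_assoc)

lemma has_derivative_mpow: "((\<lambda>M. mpow M k) has_derivative dmpow M M k) (at M within S)"
proof (induction k)
  case 0
  then show ?case by (simp add: dmpow_def)
next
  case (Suc k)
  have "((\<lambda>M. M ** mpow M k) has_derivative (\<lambda>E. M ** dmpow M M k E + E ** mpow M k)) (at M within S)"
    by (intro matrix_mult.FDERIV has_derivative_ident Suc)
  then show ?case
    by (simp add: mpow_Suc dmpow_Suc[abs_def] add.commute)
qed

text \<open>The factor \<open>norm (mat 1)\<close> comes from the Frobenius norm, in which the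
  identity of size \<open>n\<close> has norm \<open>sqrt n\<close>.\<close>

lemma norm_mpow_le: "norm (mpow (A :: complex^'n^'n) k) \<le> norm (mat 1 :: complex^'n^'n) * norm A ^ k"
proof (induction k)
  case (Suc k)
  have "norm (mpow A (Suc k)) \<le> norm A * norm (mpow A k)"
    unfolding mpow_Suc by (rule norm_matrix_mult_le)
  also have "\<dots> \<le> norm A * (norm (mat 1 :: complex^'n^'n) * norm A ^ k)"
    by (intro mult_left_mono Suc) simp
  finally show ?case by (simp add: ac_simps)
qed simp

lemma norm_dmpow_le:
  fixes M E :: "complex^'n^'n"
  assumes "norm M \<le> R"
  shows "norm (dmpow M M k E) \<le> (norm (mat 1 :: complex^'n^'n))\<^sup>2 * (real k * R ^ (k - 1)) * norm E"
proof -
  let ?c = "norm (mat 1 :: complex^'n^'n)"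
  have mp: "norm (mpow M i) \<le> ?c * R ^ i" for i
    using assms by (intro order_trans[OF norm_mpow_le] mult_left_mono power_mono) auto
  have R: "R \<ge> 0" using assms norm_ge_zero order_trans by blast
  have "norm (mpow M i ** E ** mpow M (k - 1 - i)) \<le> ?c\<^sup>2 * R ^ (k - 1) * norm E" if "i < k" for i
  proof -
    have "norm (mpow M i ** E ** mpow M (k - 1 - i)) \<le> norm (mpow M i) * norm E * norm (mpow M (k - 1 - i))"
      by (intro order_trans[OF norm_matrix_mult_le] mult_right_mono norm_matrix_mult_le) auto
    also have "\<dots> \<le> (?c * R ^ i) * norm E * (?c * R ^ (k - 1 - i))"
      using R by (intro mult_mono mp) auto
    also have "\<dots> = ?c\<^sup>2 * (R ^ i * R ^ (k - 1 - i)) * norm E" by (simp add: power2_eq_square)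
    also have "R ^ i * R ^ (k - 1 - i) = R ^ (k - 1)" using that by (simp flip: power_add)
    finally show ?thesis .
  qed
  then have "norm (dmpow M M k E) \<le> (\<Sum>i<k. ?c\<^sup>2 * R ^ (k - 1) * norm E)"
    unfolding dmpow_def by (intro sum_norm_le) auto
  then show ?thesis by (simp add: ac_simps)
qed

lemma summable_exp_derivative: "summable (\<lambda>k. real k * R ^ (k - 1) / fact k)"
proof -
  have "real (Suc k) * R ^ (Suc k - 1) / fact (Suc k) = inverse (fact k) * R ^ k" for k
    by (simp add: field_simps del: of_nat_Suc)
  then show ?thesis
    using summable_exp[of R] by (subst summable_Suc_iff[symmetric]) simp
qed

text \<open>Termwise differentiation of the series on a ball around 0: there the derivatives of the
  terms are dominated by \<open>c k * norm E\<close>, with \<open>c\<close> summable and independent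
  of the point.\<close>

lemma has_derivative_mexp:
  "(mexp has_derivative (\<lambda>E. \<Sum>k. (1 / fact k) *\<^sub>R dmpow M M k E)) (at (M :: complex^'n^'n))"
proof -
  \<comment> \<open>The margin 1 puts \<open>M\<close> inside the open ball, so the derivative
    within \<open>S\<close> is the full derivative.\<close>
  define R where "R = norm M + 1"
  define S where "S = ball (0 :: complex^'n^'n) R"
  define c where "c k = (norm (mat 1 :: complex^'n^'n))\<^sup>2 * (real k * R ^ (k - 1) / fact k)" for k
  let ?f = "\<lambda>k M. (1 / fact k) *\<^sub>R mpow (M :: complex^'n^'n) k"
  let ?f' = "\<lambda>k M E. (1 / fact k) *\<^sub>R dmpow M (M :: complex^'n^'n) k E"
  have R: "R > 0" by (simp add: R_def add_nonneg_pos)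
  have c: "summable c" unfolding c_def by (intro summable_mult summable_exp_derivative)
  have bound: "norm (?f' k X E) \<le> c k * norm E" if "X \<in> S" for k X E
  proof -
    have "norm X \<le> R" using that by (simp add: S_def)
    from norm_dmpow_le[OF this, of k E] show ?thesis
      by (simp add: c_def divide_right_mono mult.assoc)
  qed
  have sum': "summable (\<lambda>k. norm (?f' k X E))" if "X \<in> S" for X E
    by (rule summable_comparison_test[OF _ summable_mult2[OF c, of "norm E"]])
      (use bound[OF that] in auto)
  have sumf: "summable (\<lambda>k. ?f k X)" for X
  proof (rule summable_norm_cancel, rule summable_comparison_test)
    show "summable (\<lambda>k. norm (mat 1 :: complex^'n^'n) * (inverse (fact k) * norm X ^ k))"
      by (intro summable_mult summable_exp)
    show "\<exists>N. \<forall>n\<ge>N. norm (norm (?f n X)) \<le> norm (mat 1 :: complex^'n^'n) * (inverse (fact n) * norm X ^ n)"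
    proof (intro exI allI impI)
      fix n
      have "inverse (fact n) * norm (mpow X n) \<le> inverse (fact n) * (norm (mat 1 :: complex^'n^'n) * norm X ^ n)"
        by (intro mult_left_mono norm_mpow_le) auto
      then show "norm (norm (?f n X)) \<le> norm (mat 1 :: complex^'n^'n) * (inverse (fact n) * norm X ^ n)"
        by (simp add: divide_inverse ac_simps)
    qed
  qed
  have "\<exists>g. \<forall>X\<in>S. (\<lambda>k. ?f k X) sums (g X) \<and> (g has_derivative (\<lambda>E. \<Sum>k. ?f' k X E)) (at X within S)"
  proof (rule has_derivative_series)
    show "convex S" by (simp add: S_def)
    show "(?f k has_derivative ?f' k X) (at X within S)" for k X
      by (intro has_derivative_scaleR_right has_derivative_mpow)
    show "M \<in> S" by (simp add: S_def R_def)
    show "(\<lambda>k. ?f k M) sums (\<Sum>k. ?f k M)" using sumf by (rule summable_sums)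
    fix e :: real assume "e > 0"
    obtain N where N: "\<And>n. n \<ge> N \<Longrightarrow> norm (\<Sum>i. c (i + n)) < e"
      using suminf_exist_split[OF \<open>e > 0\<close> c] by blast
    show "\<forall>\<^sub>F n in sequentially. \<forall>X\<in>S. \<forall>E :: complex^'n^'n. norm ((\<Sum>i<n. ?f' i X E) - (\<Sum>k. ?f' k X E)) \<le> e * norm E"
      unfolding eventually_sequentially
    proof (intro exI[of _ N] allI impI ballI)
      fix n X and E :: "complex^'n^'n" assume n: "n \<ge> N" and X: "X \<in> S"
      have sc: "summable (\<lambda>i. c (i + n) * norm E)"
        using c by (intro summable_mult2) (simp add: summable_iff_shift)
      have "(\<Sum>i<n. ?f' i X E) - (\<Sum>k. ?f' k X E) = - (\<Sum>i. ?f' (i + n) X E)"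
        using suminf_minus_initial_segment[OF summable_norm_cancel[OF sum'[OF X, of E]], of n] by simp
      then have "norm ((\<Sum>i<n. ?f' i X E) - (\<Sum>k. ?f' k X E)) \<le> (\<Sum>i. c (i + n) * norm E)"
        using norm_suminf_le[OF bound[OF X] sc] by simp
      also have "\<dots> = (\<Sum>i. c (i + n)) * norm E"
        using c by (intro suminf_mult2[symmetric]) (simp add: summable_iff_shift)
      also have "\<dots> \<le> e * norm E" using N[OF n] by (intro mult_right_mono) auto
      finally show "norm ((\<Sum>i<n. ?f' i X E) - (\<Sum>k. ?f' k X E)) \<le> e * norm E" .
    qed
  qed
  then obtain g where g: "\<And>X. X \<in> S \<Longrightarrow> (\<lambda>k. ?f k X) sums g X"
    and g': "\<And>X. X \<in> S \<Longrightarrow> (g has_derivative (\<lambda>E. \<Sum>k. ?f' k X E)) (at X within S)"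
    by blast
  have M: "M \<in> S" "open S" by (simp_all add: S_def R_def)
  have "g X = mexp X" if "X \<in> S" for X
    using sums_unique[OF g[OF that]] by (simp add: mexp_def)
  moreover have "(g has_derivative (\<lambda>E. \<Sum>k. ?f' k M E)) (at M)"
    using g'[OF M(1)] at_within_open[OF M] by simp
  ultimately show ?thesis
    using has_derivative_transform_within_open[OF _ M(2,1)] by blast
qed

lemma dop_dmpow:
  assumes "unitary_diagonalization A U a" "unitary_diagonalization B W b"
  shows "dop U a W b (\<lambda>x y. of_real (c * (\<Sum>i<k. x ^ i * y ^ (k - 1 - i)))) E = c *\<^sub>R dmpow A B k E"
proof -
  have "dop U a W b (\<lambda>x y. of_real (c * (\<Sum>i<k. x ^ i * y ^ (k - 1 - i)))) E
      = dop U a W b (\<lambda>x y. of_real c * (\<Sum>i<k. of_real x ^ i * of_real y ^ (k - 1 - i))) E"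
    by simp
  also have "\<dots> = c *\<^sub>R dmpow A B k E"
    unfolding dop_scaleR dop_sum dop_monomial[OF assms] dmpow_def ..
  finally show ?thesis .
qed

text \<open>The Daleckii-Krein formula: the derivative series and the series of
  \<open>exp_dd\<close> agree term by term.\<close>

lemma L_exp_eq_dop:
  assumes "unitary_diagonalization A U a"
  shows "L_exp A E = dop U a U a (\<lambda>x y. of_real (exp_dd x y)) E"
proof -
  have "L_exp A E = (\<Sum>k. (1 / fact k) *\<^sub>R dmpow A A k E)"
    unfolding L_exp_def frechet_derivative_at[OF has_derivative_mexp, symmetric] ..
  moreover have "(\<lambda>k. dop U a U a (\<lambda>x y. of_real (1 / fact k * (\<Sum>i<k. x ^ i * y ^ (k - 1 - i)))) E)
      sums dop U a U a (\<lambda>x y. of_real (exp_dd x y)) E"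
    by (intro dop_sums sums_of_real exp_dd_sums)
  ultimately show ?thesis
    unfolding dop_dmpow[OF assms assms] by (simp add: sums_iff)
qed

lemma dop_dd_poly:
  assumes "unitary_diagonalization A U a" "unitary_diagonalization B W b"
  shows "dop U a W b (\<lambda>x y. of_real (dd_poly p x y)) E = (\<Sum>k\<le>degree p. coeff p k *\<^sub>R dmpow A B k E)"
proof -
  have "dop U a W b (\<lambda>x y. of_real (dd_poly p x y)) E
      = dop U a W b (\<lambda>x y. \<Sum>k\<le>degree p. of_real (coeff p k * (\<Sum>i<k. x ^ i * y ^ (k - 1 - i)))) E"
    by (simp add: dd_poly_def)
  also have "\<dots> = (\<Sum>k\<le>degree p. coeff p k *\<^sub>R dmpow A B k E)"
    unfolding dop_sum dop_dmpow[OF assms] ..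
  finally show ?thesis .
qed

text \<open>The integrand is split as \<open>h w / (w - x) + exp y / ((w - x) * (w - y))\<close>
  with the divided difference \<open>h w = (exp w - exp y) / (w - y)\<close>. Cauchy's formula
  evaluates the first part, and the second integrates to 0.\<close>

lemma contour_integral_exp_dd:
  fixes x y :: real
  assumes \<Gamma>: "valid_path \<Gamma>" "pathfinish \<Gamma> = pathstart \<Gamma>"
    and x: "complex_of_real x \<notin> path_image \<Gamma>" "winding_number \<Gamma> (of_real x) = 1"
    and y: "complex_of_real y \<notin> path_image \<Gamma>" "winding_number \<Gamma> (of_real y) = 1"
  shows "((\<lambda>\<mu>. exp \<mu> * (1 / (\<mu> - of_real x) * (1 / (\<mu> - of_real y)))) has_contour_integral
           2 * of_real pi * \<i> * of_real (exp_dd x y)) \<Gamma>"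
proof -
  let ?x = "complex_of_real x" and ?y = "complex_of_real y"
  \<comment> \<open>With the derivative as its value at \<open>y\<close>, \<open>h\<close> is
    entire.\<close>
  define h where "h = (\<lambda>z. if z = ?y then deriv exp ?y else (exp z - exp ?y) / (z - ?y))"
  have "h holomorphic_on UNIV"
    unfolding h_def by (rule pole_lemma) (auto intro: holomorphic_intros)
  from Cauchy_integral_formula_convex_simple[OF convex_UNIV this _ \<Gamma>(1) _ \<Gamma>(2), of ?x]
  have 1: "((\<lambda>w. h w / (w - ?x)) has_contour_integral (2 * pi * \<i> * h ?x)) \<Gamma>"
    using x by auto
  have hx: "h ?x = of_real (exp_dd x y)"
    by (simp add: h_def exp_dd_def DERIV_imp_deriv[OF DERIV_exp] exp_of_real)
  \<comment> \<open>For \<open>x = y\<close> there is a primitive; otherwise partial fractions give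
    a multiple of the difference of the two winding numbers, both 1.\<close>
  have 2: "((\<lambda>w. 1 / ((w - ?x) * (w - ?y))) has_contour_integral 0) \<Gamma>"
  proof (cases "x = y")
    case True
    have "((\<lambda>w. 1 / (w - ?x)\<^sup>2) has_contour_integral 0) \<Gamma>"
    proof (rule Cauchy_theorem_primitive[OF _ \<Gamma>(1) _ \<Gamma>(2)])
      show "((\<lambda>w. - 1 / (w - ?x)) has_field_derivative 1 / (z - ?x)\<^sup>2) (at z within - {?x})"
        if "z \<in> - {?x}" for z
        using that by (auto intro!: derivative_eq_intros simp: power2_eq_square)
      show "path_image \<Gamma> \<subseteq> - {?x}" using x by auto
    qed
    then show ?thesis using True by (simp add: power2_eq_square)
  next
    case False
    have "((\<lambda>w. 1 / (w - ?x) - 1 / (w - ?y)) has_contour_integral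
        2 * pi * \<i> * winding_number \<Gamma> ?x - 2 * pi * \<i> * winding_number \<Gamma> ?y) \<Gamma>"
      by (intro has_contour_integral_diff has_contour_integral_winding_number \<Gamma> x y)
    from has_contour_integral_lmul[OF this, of "1 / (?x - ?y)"]
    have "((\<lambda>w. 1 / (?x - ?y) * (1 / (w - ?x) - 1 / (w - ?y))) has_contour_integral 0) \<Gamma>"
      using x y by simp
    then show ?thesis
    proof (rule has_contour_integral_eq)
      fix w assume "w \<in> path_image \<Gamma>"
      then have "w - ?x \<noteq> 0" "w - ?y \<noteq> 0" "?x - ?y \<noteq> 0" using x y False by auto
      then show "1 / (?x - ?y) * (1 / (w - ?x) - 1 / (w - ?y)) = 1 / ((w - ?x) * (w - ?y))"
        by (simp add: field_simps)
    qed
  qed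
  have "((\<lambda>w. h w / (w - ?x) + exp ?y * (1 / ((w - ?x) * (w - ?y)))) has_contour_integral
      2 * pi * \<i> * h ?x + exp ?y * 0) \<Gamma>"
    by (intro has_contour_integral_add has_contour_integral_lmul 1 2)
  then show ?thesis
    unfolding hx mult_zero_right add_0_right of_real_mult of_real_numeral
  proof (rule has_contour_integral_eq)
    fix w assume "w \<in> path_image \<Gamma>"
    then have *: "w \<noteq> ?x" "w \<noteq> ?y" using x y by auto
    then show "h w / (w - ?x) + exp ?y * (1 / ((w - ?x) * (w - ?y)))
        = exp w * (1 / (w - ?x) * (1 / (w - ?y)))"
      by (simp add: h_def add_divide_distrib[symmetric] diff_divide_distrib mult.commute)
  qed
qed

lemma matrix_inv_eqI:
  fixes A :: "complex^'n^'n"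
  assumes "A ** B = mat 1"
  shows "matrix_inv A = B"
proof -
  have BA: "B ** A = mat 1" using assms by (rule matrix_left_right_inverse1)
  have "A ** matrix_inv A = mat 1 \<and> matrix_inv A ** A = mat 1"
    unfolding matrix_inv_def by (rule someI[of _ B]) (simp add: assms BA)
  then show ?thesis by (metis assms matrix_mul_assoc matrix_mul_lid matrix_mul_rid)
qed

lemma matrix_inv_resolvent:
  assumes "unitary_diagonalization A U a" and \<mu>: "\<And>i. \<mu> \<noteq> of_real (a i)"
  shows "matrix_inv (mat \<mu> - A) = U ** diag (\<lambda>i. 1 / (\<mu> - of_real (a i))) ** ctranspose U"
proof (rule matrix_inv_eqI)
  have U: "ctranspose U ** U = mat 1" "U ** ctranspose U = mat 1"
    and A: "A = U ** diag (\<lambda>i. of_real (a i)) ** ctranspose U"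
    using assms by (auto simp: unitary_diagonalization_def)
  have "mat \<mu> ** U = U ** mat \<mu>"
    using diag_mult[of "\<lambda>_. \<mu>" U] mult_diag[of U "\<lambda>_. \<mu>"]
    by (simp add: vec_eq_iff diag_def mat_def mult.commute)
  then have "U ** mat \<mu> ** ctranspose U = mat \<mu>"
    by (metis U(2) matrix_mul_assoc matrix_mul_rid)
  then have "mat \<mu> - A = U ** (mat \<mu> - diag (\<lambda>i. of_real (a i))) ** ctranspose U"
    by (simp add: A matrix_mult.diff_left matrix_mult.diff_right)
  then have "(mat \<mu> - A) ** (U ** diag (\<lambda>i. 1 / (\<mu> - of_real (a i))) ** ctranspose U)
      = U ** (mat \<mu> - diag (\<lambda>i. of_real (a i))) ** (ctranspose U ** U)
          ** diag (\<lambda>i. 1 / (\<mu> - of_real (a i))) ** ctranspose U"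
    by (simp only: matrix_mul_assoc)
  also have "\<dots> = U ** ((mat \<mu> - diag (\<lambda>i. of_real (a i))) ** diag (\<lambda>i. 1 / (\<mu> - of_real (a i)))) ** ctranspose U"
    by (simp add: U matrix_mul_assoc)
  also have "(mat \<mu> - diag (\<lambda>i. of_real (a i))) ** diag (\<lambda>i. 1 / (\<mu> - of_real (a i))) = mat 1"
    using \<mu> by (simp add: vec_eq_iff mult_diag) (simp add: diag_def mat_def)
  finally show "(mat \<mu> - A) ** (U ** diag (\<lambda>i. 1 / (\<mu> - of_real (a i))) ** ctranspose U) = mat 1"
    by (simp add: U)
qed

text \<open>Diagonalizing both resolvents turns the integrand into a \<open>dop\<close> whose kernel
  is a product of two simple poles; \<open>contour_integral_exp_dd\<close> then integrates its
  finitely many terms.\<close>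

lemma arnoldi_core_eq_dop:
  fixes G H :: "complex^'m::{finite,linorder}^'m::{finite,linorder}"
  assumes G: "unitary_diagonalization (\<tau> *\<^sub>R G) U a"
    and H: "unitary_diagonalization (\<tau> *\<^sub>R ctranspose H) W b"
    and \<Gamma>: "valid_path \<Gamma>" "pathfinish \<Gamma> = pathstart \<Gamma>"
    and a: "\<And>i. complex_of_real (a i) \<notin> path_image \<Gamma>" "\<And>i. winding_number \<Gamma> (of_real (a i)) = 1"
    and b: "\<And>i. complex_of_real (b i) \<notin> path_image \<Gamma>" "\<And>i. winding_number \<Gamma> (of_real (b i)) = 1"
  shows "arnoldi_core \<tau> c G H \<Gamma> = c *\<^sub>R dop U a W b (\<lambda>x y. of_real (exp_dd x y)) (outer e1 e1)"
proof -
  let ?C = "\<lambda>i j k l. U $ i $ k * (ctranspose U ** outer e1 e1 ** W) $ k $ l * cnj (W $ j $ l)"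
  let ?F = "\<lambda>i j \<mu>. exp \<mu> * of_real c *
         (matrix_inv (mat \<mu> - \<tau> *\<^sub>R G) ** outer e1 e1 **
          matrix_inv (mat \<mu> - \<tau> *\<^sub>R ctranspose H)) $ i $ j"
  let ?r = "\<lambda>\<mu> k l. 1 / (\<mu> - of_real (a k)) * (1 / (\<mu> - of_real (b l)))"
  have F: "?F i j \<mu> = (\<Sum>l\<in>UNIV. \<Sum>k\<in>UNIV. of_real c * ?C i j k l * (exp \<mu> * ?r \<mu> k l))"
    if "\<mu> \<in> path_image \<Gamma>" for i j \<mu>
  proof -
    have nz: "\<mu> \<noteq> of_real (a k)" "\<mu> \<noteq> of_real (b k)" for k using that a b by auto
    have "matrix_inv (mat \<mu> - \<tau> *\<^sub>R G) ** outer e1 e1 ** matrix_inv (mat \<mu> - \<tau> *\<^sub>R ctranspose H)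
        = dop U a W b (\<lambda>x y. 1 / (\<mu> - of_real x) * (1 / (\<mu> - of_real y))) (outer e1 e1)"
      unfolding dop_product matrix_inv_resolvent[OF G nz(1)] matrix_inv_resolvent[OF H nz(2)] ..
    then show ?thesis
      by (simp only: dop_entry sum_distrib_left) (simp only: ac_simps)
  qed
  have ci: "contour_integral \<Gamma> (?F i j) = (\<Sum>l\<in>UNIV. \<Sum>k\<in>UNIV.
      of_real c * ?C i j k l * (2 * of_real pi * \<i> * of_real (exp_dd (a k) (b l))))" for i j
  proof (rule contour_integral_unique, rule has_contour_integral_eq)
    show "((\<lambda>\<mu>. \<Sum>l\<in>UNIV. \<Sum>k\<in>UNIV. of_real c * ?C i j k l * (exp \<mu> * ?r \<mu> k l)) has_contour_integral
      (\<Sum>l\<in>UNIV. \<Sum>k\<in>UNIV. of_real c * ?C i j k l * (2 * of_real pi * \<i> * of_real (exp_dd (a k) (b l))))) \<Gamma>"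
      by (intro has_contour_integral_sum has_contour_integral_lmul contour_integral_exp_dd \<Gamma> a b) auto
  qed (simp only: F)
  have cancel: "1 / (2 * of_real pi * \<i>) * (z * w * (2 * of_real pi * \<i> * d)) = z * (d * w)" for z w d
    by (simp add: field_simps)
  have "1 / (2 * of_real pi * \<i>) * contour_integral \<Gamma> (?F i j)
      = of_real c * (\<Sum>l\<in>UNIV. \<Sum>k\<in>UNIV. of_real (exp_dd (a k) (b l)) * ?C i j k l)" for i j
    unfolding ci sum_distrib_left by (intro sum.cong refl cancel)
  then show ?thesis
    by (simp only: vec_eq_iff arnoldi_core_def dop_entry vec_lambda_beta vector_scaleR_component
        scaleR_conv_of_real[where 'a = complex] simp_thms)
qed

section \<open>Exactness on polynomials and the error bound\<close>

lemma range_projection: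
  fixes V :: "complex^'m^'n"
  assumes "ctranspose V ** V = mat 1" "x \<in> vec.span (range (\<lambda>j. column j V))"
  shows "(V ** ctranspose V) *v x = x"
  using assms(2)
proof (induction rule: vec.span_induct_alt)
  case (step c x y)
  then obtain j where x: "x = column j V" by blast
  have "(V ** ctranspose V) *v column j V = column j (V ** (ctranspose V ** V))"
    by (simp only: column_mult[symmetric] matrix_mul_assoc)
  then have "(V ** ctranspose V) *v x = x" by (simp add: assms(1) x)
  with step show ?case by (simp add: matrix_vector_right_distrib vector_scalar_commute)
qed simp

text \<open>Each new power of \<open>B\<close> applied to \<open>y\<close> still lies in the range
  of \<open>V\<close>, so the projection \<open>V ** ctranspose V\<close> may be inserted before
  multiplying on. The power \<open>m\<close> itself may leave the Krylov space, whence
  \<open>i < m\<close>.\<close>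

lemma compression_mpow:
  fixes V :: "complex^'m^'n"
  assumes V: "ctranspose V ** V = mat 1"
    and range: "\<And>i. i < m \<Longrightarrow> (V ** ctranspose V) *v (mpow B i *v y) = mpow B i *v y"
    and "i < m"
  shows "mpow B i *v y = V *v (mpow (ctranspose V ** B ** V) i *v (ctranspose V *v y))"
  using assms(3)
proof (induction i)
  case 0
  then show ?case using range[OF 0] by (simp add: matrix_vector_mul_assoc)
next
  case (Suc i)
  have "mpow B (Suc i) *v y = (V ** ctranspose V) *v (mpow B (Suc i) *v y)"
    using range[OF Suc.prems] by simp
  also have "\<dots> = (V ** ctranspose V) *v (B *v (mpow B i *v y))"
    by (simp only: mpow_Suc matrix_vector_mul_assoc matrix_mul_assoc)
  also have "mpow B i *v y = V *v (mpow (ctranspose V ** B ** V) i *v (ctranspose V *v y))"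
    using Suc by simp
  finally show ?case
    by (simp only: mpow_Suc matrix_vector_mul_assoc matrix_mul_assoc)
qed

lemma hermitian_mpow: "hermitian A \<Longrightarrow> hermitian (mpow A k)"
proof (induction k)
  case 0
  then show ?case by (auto simp: hermitian_def ctranspose_def mat_def vec_eq_iff)
next
  case (Suc k)
  have comm: "mpow A k ** A = A ** mpow A k" for k
    by (induction k) (simp_all add: mpow_Suc flip: matrix_mul_assoc)
  show ?case
    using Suc comm[of k] by (simp add: hermitian_def ctranspose_mult mpow_Suc)
qed

lemma hermitian_compression: "hermitian A \<Longrightarrow> hermitian (ctranspose V ** A ** V)"
  by (simp add: hermitian_def ctranspose_mult matrix_mul_assoc)

lemma hermitian_scaleR: "hermitian A \<Longrightarrow> hermitian (c *\<^sub>R A)"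
  by (simp add: hermitian_def ctranspose_scaleR)

text \<open>In each summand the exponents \<open>i\<close> and \<open>k - 1 - i\<close> are both
  below \<open>m\<close>, so the two Krylov identities apply. Being Hermitian lets the right factor
  act on \<open>z\<close> through \<open>outer_mult\<close>.\<close>

lemma dmpow_compression:
  fixes V :: "complex^'m^'n" and W :: "complex^'k^'l"
  assumes A: "\<And>i. i < m \<Longrightarrow> mpow A i *v y = V *v (mpow G i *v y')"
    and B: "\<And>i. i < m \<Longrightarrow> mpow B i *v z = W *v (mpow H i *v z')"
    and herm: "hermitian B" "hermitian H" and "k \<le> m"
  shows "dmpow A B k (outer y z) = V ** dmpow G H k (outer y' z') ** ctranspose W"
proof -
  have cB: "mpow B j = ctranspose (mpow B j)" and cH: "mpow H j = ctranspose (mpow H j)" for j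
    using herm hermitian_mpow unfolding hermitian_def by (metis, metis)
  have "mpow A i ** outer y z ** mpow B (k - 1 - i)
      = V ** (mpow G i ** outer y' z' ** mpow H (k - 1 - i)) ** ctranspose W" if "i < k" for i
  proof -
    have "i < m" "k - 1 - i < m" using that assms by auto
    then show ?thesis
      by (subst cB, subst cH) (simp only: outer_mult A B)
  qed
  then show ?thesis
    unfolding dmpow_def by (simp add: matrix_mult.sum_left matrix_mult.sum_right)
qed

section \<open>Quadratic forms and spectra of compressions\<close>

lemma quadratic_form_bounds:
  assumes "unitary_diagonalization A U a" and "\<And>i. a i \<in> {l..u}"
  shows "Re (cdot x (A *v x)) \<in> {l * (norm x)\<^sup>2..u * (norm x)\<^sup>2}"
proof -
  let ?w = "ctranspose U *v x"
  have U: "ctranspose (ctranspose U) ** ctranspose U = mat 1"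
    and A: "A = U ** diag (\<lambda>i. of_real (a i)) ** ctranspose U"
    using assms(1) by (auto simp: unitary_diagonalization_def)
  have nw: "norm ?w = norm x" by (rule norm_isometry[OF U])
  have dw: "(diag d *v v) $ i = d i * v $ i" for d v i
    by (simp add: matrix_vector_mult_def diag_def if_distrib[of "\<lambda>x. x * _"] cong: if_cong)
  have "cdot x (A *v x) = cdot ?w (diag (\<lambda>i. of_real (a i)) *v ?w)"
    by (simp add: A cdot_ctranspose matrix_vector_mul_assoc matrix_mul_assoc)
  also have "\<dots> = (\<Sum>i\<in>UNIV. of_real (a i) * (cnj (?w $ i) * ?w $ i))"
    by (simp add: cdot_def dw ac_simps)
  also have "\<dots> = of_real (\<Sum>i\<in>UNIV. a i * (cmod (?w $ i))\<^sup>2)"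
    by (simp only: of_real_sum of_real_mult complex_norm_square mult.commute[of "cnj _"])
  finally have q: "Re (cdot x (A *v x)) = (\<Sum>i\<in>UNIV. a i * (cmod (?w $ i))\<^sup>2)" by simp
  have n: "(norm x)\<^sup>2 = (\<Sum>i\<in>UNIV. (cmod (?w $ i))\<^sup>2)"
    unfolding nw[symmetric] by (simp only: norm_vec_def) (simp add: L2_set_def sum_nonneg)
  show ?thesis
    unfolding q n sum_distrib_left using assms(2) by (auto intro!: sum_mono mult_right_mono)
qed

text \<open>An eigenvalue of the compression with eigenvector \<open>v\<close> is the Rayleigh
  quotient of \<open>A\<close> at \<open>V *v v\<close>.\<close>

lemma compression_spectrum:
  fixes V :: "complex^'m^'n"
  assumes "unitary_diagonalization A U a" "\<And>i. a i \<in> {l..u}"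
    and V: "ctranspose V ** V = mat 1"
    and \<mu>: "complex_of_real \<mu> \<in> spectrum (ctranspose V ** A ** V)"
  shows "\<mu> \<in> {l..u}"
proof -
  obtain v where v: "v \<noteq> 0" "(ctranspose V ** A ** V) *v v = complex_of_real \<mu> *s v"
    using \<mu> by (auto simp: spectrum_def)
  have "cdot (V *v v) (A *v (V *v v)) = cdot v ((ctranspose V ** A ** V) *v v)"
    using cdot_ctranspose[of "ctranspose V" v "A *v (V *v v)"]
    by (simp add: matrix_vector_mul_assoc matrix_mul_assoc)
  also have "\<dots> = of_real (\<mu> * (norm v)\<^sup>2)" by (simp add: v cdot_simps cdot_self)
  finally have "Re (cdot (V *v v) (A *v (V *v v))) = \<mu> * (norm v)\<^sup>2" by simp
  then have "\<mu> * (norm v)\<^sup>2 \<in> {l * (norm v)\<^sup>2..u * (norm v)\<^sup>2}"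
    using quadratic_form_bounds[OF assms(1,2), of "V *v v"] by (simp add: norm_isometry[OF V])
  then show ?thesis using v by simp
qed

text \<open>A degree below \<open>m\<close> for \<open>q\<close> becomes at most \<open>m\<close>
  for \<open>p\<close>, which is the range covered by \<open>dmpow_compression\<close>.\<close>

lemma poly_antiderivative:
  fixes q :: "real poly"
  obtains p where "pderiv p = q" "degree p \<le> Suc (degree q)"
proof (rule that)
  let ?p = "pCons 0 (\<Sum>k\<le>degree q. monom (coeff q k / real (Suc k)) k)"
  have c: "coeff (\<Sum>k\<le>degree q. monom (coeff q k / real (Suc k)) k) i = coeff q i / real (Suc i)" for i
    by (simp add: coeff_sum coeff_eq_0 del: of_nat_Suc)
  show "pderiv ?p = q"
    by (simp add: poly_eq_iff coeff_pderiv c del: of_nat_Suc)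
  have "degree (\<Sum>k\<le>degree q. monom (coeff q k / real (Suc k)) k) \<le> degree q"
    by (intro degree_le) (simp add: c coeff_eq_0 del: of_nat_Suc)
  then show "degree ?p \<le> Suc (degree q)"
    by (meson degree_pCons_le le_trans Suc_le_mono)
qed

text \<open>The Frechet derivative and its approximation each differ by at most
  \<open>C * norm y * norm z\<close> from their counterparts for a polynomial \<open>p\<close>, and
  these counterparts coincide; this accounts for the factor 2. As \<open>A\<close> is Hermitian,
  \<open>W\<close> is built from \<open>A\<close> itself.\<close>

lemma arnoldi_error_le:
  fixes A :: "complex^'n^'n" and V W :: "complex^'m::{finite,linorder}^'n"
  assumes herm: "hermitian A"
    and spec: "\<And>\<mu>. complex_of_real \<mu> \<in> spectrum (\<tau> *\<^sub>R A) \<Longrightarrow> \<mu> \<in> {l..u}"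
    and dim: "vec.dim (krylov CARD('m) A y) = CARD('m)" "vec.dim (krylov CARD('m) A z) = CARD('m)"
    and V: "V = arnoldi_matrix A y" and W: "W = arnoldi_matrix A z"
    and wind: "winds_once_around \<Gamma> (spectrum (\<tau> *\<^sub>R arnoldi_G A V) \<union> spectrum (\<tau> *\<^sub>R arnoldi_G A W))"
    and q: "degree q < CARD('m)" "\<And>x. x \<in> {l..u} \<Longrightarrow> \<bar>exp x - poly q x\<bar> \<le> C"
  shows "spectral_norm (L_exp (\<tau> *\<^sub>R A) (outer y z) - L_arnoldi \<tau> A y z V W \<Gamma>) \<le> 2 * C * norm y * norm z"
proof -
  define B where "B = \<tau> *\<^sub>R A"
  have hB: "hermitian B" unfolding B_def by (rule hermitian_scaleR) (rule herm)
  have B_pow: "mpow B k = \<tau> ^ k *\<^sub>R mpow A k" for k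
    by (induction k) (simp_all add: B_def mpow_Suc matrix_mult_scaleR_left matrix_mult_scaleR_right)
  note basisV = arnoldi_matrix_basis[OF dim(1), folded V]
  note basisW = arnoldi_matrix_basis[OF dim(2), folded W]
  define G where "G = ctranspose V ** B ** V"
  define H where "H = ctranspose W ** B ** W"
  have G: "\<tau> *\<^sub>R arnoldi_G A V = G" and H: "\<tau> *\<^sub>R arnoldi_G A W = H"
    by (simp_all add: G_def H_def B_def arnoldi_G_def matrix_mult_scaleR_left matrix_mult_scaleR_right)
  have hG: "hermitian G" and hH: "hermitian H"
    unfolding G_def H_def by (intro hermitian_compression hB)+
  have cA: "ctranspose A = A" using herm by (simp add: hermitian_def)
  have cH: "\<tau> *\<^sub>R ctranspose (arnoldi_G A W) = H"
    using hH by (simp add: hermitian_def ctranspose_scaleR flip: H)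
  obtain U a where U: "unitary_diagonalization B U a" using hermitian_diagonalization[OF hB] .
  obtain U1 a1 where U1: "unitary_diagonalization G U1 a1" using hermitian_diagonalization[OF hG] .
  obtain U2 a2 where U2: "unitary_diagonalization H U2 a2" using hermitian_diagonalization[OF hH] .
  have a: "a i \<in> {l..u}" for i
    using spec unitary_diagonalization_spectrum[OF U] unfolding B_def by blast
  have a1: "a1 i \<in> {l..u}" for i
    by (rule compression_spectrum[OF U a basisV(1)])
      (use unitary_diagonalization_spectrum[OF U1] in \<open>simp add: G_def\<close>)
  have a2: "a2 i \<in> {l..u}" for i
    by (rule compression_spectrum[OF U a basisW(1)])
      (use unitary_diagonalization_spectrum[OF U2] in \<open>simp add: H_def\<close>)

  obtain p where p: "pderiv p = q" "degree p \<le> Suc (degree q)" by (rule poly_antiderivative)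
  let ?\<phi> = "\<lambda>x y. complex_of_real (exp_dd x y)"
  let ?\<psi> = "\<lambda>x y. complex_of_real (dd_poly p x y)"
  let ?E = "outer y z"
  let ?F = "outer (norm y *\<^sub>R (e1 :: complex^'m::{finite,linorder})) (norm z *\<^sub>R (e1 :: complex^'m::{finite,linorder}))"
  have small: "cmod (?\<phi> x y - ?\<psi> x y) \<le> C" if "x \<in> {l..u}" "y \<in> {l..u}" for x y
    using exp_dd_dd_poly_le[of l u p C, OF _ that] q(2) unfolding p(1) norm_of_real of_real_diff[symmetric] by blast

  \<comment> \<open>The starting vector is its norm times the first basis vector; hence
    \<open>?F\<close> is the direction \<open>?E\<close> in Krylov coordinates.\<close>
  have coord: "ctranspose V *v y = norm y *\<^sub>R e1" if "ctranspose V ** V = mat 1" "V *v e1 = y /\<^sub>R norm y"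
    for V :: "complex^'m::{finite,linorder}^'n" and y
  proof (cases "y = 0")
    case False
    then have "V *v (norm y *\<^sub>R e1) = y" using that(2)
      by (simp add: scaleR_eq_smult vector_scalar_commute vector_smult_assoc)
    then show ?thesis by (metis that(1) matrix_vector_mul_assoc matrix_vector_mul_lid)
  qed simp
  have kry: "(V ** ctranspose V) *v (mpow B i *v y) = mpow B i *v y"
    if "ctranspose V ** V = mat 1" "vec.span (range (\<lambda>j. column j V)) = krylov CARD('m) A y" "i < CARD('m)"
    for V :: "complex^'m::{finite,linorder}^'n" and y i
  proof (rule range_projection[OF that(1)])
    have "mpow B i *v y = of_real (\<tau> ^ i) *s (((*v) A) ^^ i) y"
      by (simp only: B_pow mpow_mult_vec scaleR_matrix_vector_mult)
    also have "\<dots> \<in> krylov CARD('m) A y"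
      unfolding krylov_def using that(3) by (intro vec.span_scale vec.span_base) auto
    finally show "mpow B i *v y \<in> vec.span (range (\<lambda>j. column j V))" unfolding that(2) .
  qed
  have powV: "mpow B i *v y = V *v (mpow G i *v (norm y *\<^sub>R e1))" if "i < CARD('m)" for i
    using compression_mpow[OF basisV(1) kry[OF basisV(1,2)] that] coord[OF basisV(1,3)] by (simp add: G_def)
  have powW: "mpow B i *v z = W *v (mpow H i *v (norm z *\<^sub>R e1))" if "i < CARD('m)" for i
    using compression_mpow[OF basisW(1) kry[OF basisW(1,2)] that] coord[OF basisW(1,3)] by (simp add: H_def)
  have exact: "dop U a U a ?\<psi> ?E = V ** dop U1 a1 U2 a2 ?\<psi> ?F ** ctranspose W"
  proof -
    have "dmpow B B k ?E = V ** dmpow G H k ?F ** ctranspose W" if "k \<le> degree p" for k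
      by (rule dmpow_compression[OF powV powW hB hH]) (use p q that in auto)
    then show ?thesis
      unfolding dop_dd_poly[OF U U] dop_dd_poly[OF U1 U2]
      by (simp add: matrix_mult.sum_left matrix_mult.sum_right matrix_mult_scaleR_left matrix_mult_scaleR_right)
  qed
  have core: "L_arnoldi \<tau> A y z V W \<Gamma> = V ** dop U1 a1 U2 a2 ?\<phi> ?F ** ctranspose W"
  proof -
    have sp: "complex_of_real (a1 i) \<in> spectrum G" "complex_of_real (a2 i) \<in> spectrum H" for i
      using U1 U2 by (auto intro: unitary_diagonalization_spectrum)
    have "arnoldi_core \<tau> (norm y * norm z) (arnoldi_G A V) (arnoldi_G A W) \<Gamma>
        = (norm y * norm z) *\<^sub>R dop U1 a1 U2 a2 ?\<phi> (outer e1 e1)"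
      using wind sp unfolding winds_once_around_def G H
      by (intro arnoldi_core_eq_dop) (auto simp: G cH U1 U2)
    also have "\<dots> = dop U1 a1 U2 a2 ?\<phi> ?F"
      unfolding outer_scaleR dop_scaleR_right ..
    finally show ?thesis by (simp add: L_arnoldi_def cA)
  qed
  let ?X = "dop U a U a (\<lambda>x y. ?\<phi> x y - ?\<psi> x y) ?E"
  let ?Y = "dop U1 a1 U2 a2 (\<lambda>x y. ?\<phi> x y - ?\<psi> x y) ?F"
  \<comment> \<open>By \<open>exact\<close> the polynomial parts of the two terms cancel.\<close>
  have err: "L_exp (\<tau> *\<^sub>R A) ?E - L_arnoldi \<tau> A y z V W \<Gamma> = ?X - V ** ?Y ** ctranspose W"
    unfolding core L_exp_eq_dop[OF U, unfolded B_def] dop_diff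
    by (simp add: exact matrix_mult.diff_left matrix_mult.diff_right)
  have X: "norm ?X \<le> C * (norm y * norm z)"
    unfolding norm_outer[symmetric] by (rule norm_dop_le[OF U U]) (intro small a)
  have nF: "norm ?F = norm y * norm z"
    by (simp add: norm_outer e1_def norm_axis_1)
  have Y: "norm (V ** ?Y ** ctranspose W) \<le> C * (norm y * norm z)"
    unfolding norm_mult_isometry[OF basisW(1)] norm_isometry_mult[OF basisV(1)] nF[symmetric]
    by (rule norm_dop_le[OF U1 U2]) (intro small a1 a2)
  have "norm (L_exp (\<tau> *\<^sub>R A) ?E - L_arnoldi \<tau> A y z V W \<Gamma>) \<le> 2 * (C * (norm y * norm z))"
    unfolding err using norm_triangle_ineq4[of ?X "V ** ?Y ** ctranspose W"] X Y by linarith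
  then have "norm (L_exp (\<tau> *\<^sub>R A) ?E - L_arnoldi \<tau> A y z V W \<Gamma>) \<le> 2 * C * norm y * norm z"
    by (simp only: mult.assoc)
  then show ?thesis using spectral_norm_le_norm order_trans by blast
qed

theorem theorem1:
  fixes A :: "complex^'n^'n"
    and y z :: "complex^'n"
    and \<tau> \<rho> :: real
    and V W :: "complex^'m::{finite,linorder}^'n"
    and \<Gamma> :: "real \<Rightarrow> complex"
  defines "m \<equiv> CARD('m)"
  assumes "\<tau> > 0" and "\<rho> > 0"
    and "hermitian A" and "negative_semidefinite A"
    and "spectrum A \<subseteq> complex_of_real ` {- 4 * \<rho> .. 0}"
    and "y \<noteq> 0" and "z \<noteq> 0"
    and "vec.dim (krylov m A y) = m"
    and "vec.dim (krylov m (ctranspose A) z) = m"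
    and "V = arnoldi_matrix A y"
    and "W = arnoldi_matrix (ctranspose A) z"
    and "winds_once_around \<Gamma>
           (spectrum (\<tau> *\<^sub>R arnoldi_G A V) \<union> spectrum (\<tau> *\<^sub>R arnoldi_G (ctranspose A) W))"
  defines "\<epsilon> \<equiv> spectral_norm (L_exp (\<tau> *\<^sub>R A) (outer y z) - L_arnoldi \<tau> A y z V W \<Gamma>)"
  shows "(sqrt (4 * \<rho> * \<tau>) \<le> real m \<and> real m \<le> 2 * \<rho> * \<tau> \<longrightarrow>
            \<epsilon> \<le> 10 * ((4 * \<rho> * \<tau>)\<^sup>2 / (real m)\<^sup>2) * exp (- (real m)\<^sup>2 / (5 * \<rho> * \<tau>))
                  * norm y * norm z)
       \<and> (real m \<ge> 2 * \<rho> * \<tau> \<longrightarrow>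
            \<epsilon> \<le> 40 / (\<rho> * \<tau>) * exp (- (\<rho> * \<tau>)) * (exp 1 * \<rho> * \<tau> / real m) ^ m
                  * norm y * norm z)"
proof -
  define a where "a = \<rho> * \<tau>"
  have a: "a > 0" using assms by (simp add: a_def)
  have m: "m > 0" by (simp add: m_def)
  have cA: "ctranspose A = A" using assms(4) by (simp add: hermitian_def)
  have yz: "norm y * norm z > 0" using assms by simp
  have spec: "\<mu> \<in> {- 4 * a..0}" if mem: "complex_of_real \<mu> \<in> spectrum (\<tau> *\<^sub>R A)" for \<mu>
  proof -
    obtain v where v: "v \<noteq> 0" "(\<tau> *\<^sub>R A) *v v = complex_of_real \<mu> *s v"
      using mem unfolding spectrum_def by blast
    then have "complex_of_real (1 / \<tau>) *s (complex_of_real \<tau> *s (A *v v))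
        = complex_of_real (1 / \<tau>) *s (complex_of_real \<mu> *s v)"
      by (simp only: scaleR_matrix_vector_mult)
    then have "A *v v = complex_of_real (\<mu> / \<tau>) *s v"
      using \<open>\<tau> > 0\<close> by (simp add: vector_smult_assoc)
    then have "complex_of_real (\<mu> / \<tau>) \<in> spectrum A" using v unfolding spectrum_def by blast
    then have "\<mu> / \<tau> \<in> {- 4 * \<rho>..0}" using assms(6) by (metis image_iff of_real_eq_iff subsetD)
    then show ?thesis using \<open>\<tau> > 0\<close> by (simp add: a_def field_simps)
  qed
  have main: "\<epsilon> \<le> 4 * (exp (a * (r + 1 / r) - 2 * a) / r ^ m) * (norm y * norm z)" if r: "r \<ge> 1" for r
  proof (rule field_le_epsilon)
    fix e :: real assume "e > 0"
    \<comment> \<open>Scaled so that the slack contributes exactly \<open>e\<close> after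
      multiplication by the factor of \<open>arnoldi_error_le\<close>.\<close>
    define d where "d = e / (2 * (norm y * norm z))"
    have "d > 0" using \<open>e > 0\<close> yz by (simp add: d_def)
    obtain q where q: "degree q < m"
      "\<And>x. x \<in> {- 4 * a..0} \<Longrightarrow> \<bar>exp x - poly q x\<bar> \<le> 2 * exp (a * (r + 1 / r) - 2 * a) / r ^ m + d"
      using exp_poly_approx[OF a r \<open>d > 0\<close> m] by blast
    have "\<epsilon> \<le> 2 * (2 * exp (a * (r + 1 / r) - 2 * a) / r ^ m + d) * norm y * norm z"
      unfolding \<epsilon>_def
      by (rule arnoldi_error_le[OF assms(4) spec _ _ assms(11) _ _ q(1)[unfolded m_def] q(2)])
        (use assms(9,10,12,13) cA in \<open>simp_all add: m_def\<close>)
    also have "\<dots> = 4 * (exp (a * (r + 1 / r) - 2 * a) / r ^ m) * (norm y * norm z) + 2 * (norm y * norm z) * d"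
      by (simp add: algebra_simps)
    also have "2 * (norm y * norm z) * d = e" using assms(7,8) by (simp add: d_def)
    finally show "\<epsilon> \<le> 4 * (exp (a * (r + 1 / r) - 2 * a) / r ^ m) * (norm y * norm z) + e" .
  qed
  have scale: "\<epsilon> \<le> c'' * (norm y * norm z)"
    if "\<epsilon> \<le> 4 * c * (norm y * norm z)" "c \<le> c'" "4 * c' \<le> c''" for c c' c''
  proof -
    have "4 * c * (norm y * norm z) \<le> c'' * (norm y * norm z)"
      using that(2,3) yz by (intro mult_right_mono) auto
    with that(1) show ?thesis by linarith
  qed
  show ?thesis
  proof (intro conjI impI; (elim conjE)?)
    assume "real m \<le> 2 * \<rho> * \<tau>"
    then have ma: "real m \<le> 2 * a" by (simp add: a_def)
    let ?r = "exp (real m / (2 * a))"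
    have "\<epsilon> \<le> 4 * (exp (a * (?r + 1 / ?r) - 2 * a) / ?r ^ m) * (norm y * norm z)"
      using a by (intro main) auto
    moreover have "exp (a * (?r + 1 / ?r) - 2 * a) / ?r ^ m \<le> exp (- (real m)\<^sup>2 / (5 * a))"
      using Chernoff_small[of a "real m"] a m ma by (simp add: powr_realpow)
    moreover have "4 * exp (- (real m)\<^sup>2 / (5 * a)) \<le> 10 * ((4 * a)\<^sup>2 / (real m)\<^sup>2) * exp (- (real m)\<^sup>2 / (5 * a))"
    proof -
      \<comment> \<open>For \<open>m \<le> 2 * a\<close> the algebraic prefactor is at least 1, and
        the constant 4 is below 10.\<close>
      have "(real m)\<^sup>2 \<le> (4 * a)\<^sup>2" using ma a by (intro power_mono) auto
      then have "1 \<le> (4 * a)\<^sup>2 / (real m)\<^sup>2" using m by (simp add: pos_le_divide_eq)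
      then show ?thesis by (intro mult_right_mono) auto
    qed
    ultimately have "\<epsilon> \<le> 10 * ((4 * a)\<^sup>2 / (real m)\<^sup>2) * exp (- (real m)\<^sup>2 / (5 * a)) * (norm y * norm z)"
      by (rule scale)
    then show "\<epsilon> \<le> 10 * ((4 * \<rho> * \<tau>)\<^sup>2 / (real m)\<^sup>2) * exp (- (real m)\<^sup>2 / (5 * \<rho> * \<tau>)) * norm y * norm z"
      by (simp only: a_def mult.assoc)
  next
    assume "2 * \<rho> * \<tau> \<le> real m"
    then have ma: "2 * a \<le> real m" by (simp add: a_def)
    have "\<epsilon> \<le> 4 * (exp (a * (m / a + 1 / (m / a)) - 2 * a) / (m / a) ^ m) * (norm y * norm z)"
      using a ma by (intro main) (simp add: pos_le_divide_eq)
    moreover have "exp (a * (m / a + 1 / (m / a)) - 2 * a) / (m / a) ^ m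
        \<le> exp (- 3/2 * a) * (exp 1 * a / m) ^ m"
      by (rule Chernoff_large[OF a m ma])
    moreover have "4 * (exp (- 3/2 * a) * (exp 1 * a / m) ^ m) \<le> 40 / a * exp (- a) * (exp 1 * a / m) ^ m"
    proof -
      \<comment> \<open>\<open>times_exp_minus_half_le\<close> gives the constant 2 here, and 10 is
        what the target constant 40 permits.\<close>
      have "a * exp (- 3/2 * a) \<le> 10 * exp (- a)"
        using times_exp_minus_half_le[OF a] exp_ge_zero[of "- a"] by linarith
      then have "4 * exp (- 3/2 * a) \<le> 40 / a * exp (- a)" using a by (simp add: field_simps)
      then have "4 * exp (- 3/2 * a) * (exp 1 * a / m) ^ m \<le> 40 / a * exp (- a) * (exp 1 * a / m) ^ m"
        using a by (intro mult_right_mono) auto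
      then show ?thesis by (simp only: mult.assoc)
    qed
    ultimately have "\<epsilon> \<le> 40 / a * exp (- a) * (exp 1 * a / m) ^ m * (norm y * norm z)"
      by (rule scale)
    then show "\<epsilon> \<le> 40 / (\<rho> * \<tau>) * exp (- (\<rho> * \<tau>)) * (exp 1 * \<rho> * \<tau> / real m) ^ m * norm y * norm z"
      by (simp only: a_def mult.assoc)
  qed
qed

end
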